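(* Let $\mathcal S(\varphi,\psi)=(\varphi+F(\varphi,\psi),A_0\psi)$ satisfy Hypotheses 1, 2, 3 stated in the context, let $W\in\mathfrak B^*_{\alpha_-,\alpha_+}(\mathbb T^2,\mathbb R)$, with $\alpha_-,\alpha_+\in(0,\alpha_0]$, be the function whose graph is the unique invariant manifold of $\mathcal S$ in $\Lambda$, and let $$\mathcal S_0(\eta,\psi)=(\kappa(\psi)\eta,A_0\psi),\qquad \kappa(\psi)=1+\partial_\varphi F(W(\psi),\psi).$$ Then there exist a set $\Omega_0\subset\mathbb R\times\mathbb T^2$ and a function $\mathscr H:\Omega\to\Omega_0$ such that $\mathscr H\circ\mathcal S=\mathcal S_0\circ\mathscr H$ on $\Omega$. Moreover $\mathscr H$ can be written as $\mathscr H(\varphi,\psi)=(\mathcal H(\varphi,\psi),\psi)$ with $\partial_\varphi\mathcal H(W(\psi),\psi)=1$ for every $\psi\in\mathbb T^2$ and $\mathcal H\in\mathscr B_{\alpha_*,2}(\Omega,\mathbb R)$ for a suitable $\alpha_*\in(0,\min\{\alpha_-,\alpha_+\}]$.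
   Context: $\mathbb T=\mathbb R/2\pi\mathbb Z$. $A_0$ is an Anosov (hyperbolic linear) automorphism of $\mathbb T^2$, with eigenvalues $\lambda_\pm$, $|\lambda_+|>1>|\lambda_-|$, $|\lambda_+\lambda_-|=1$, and corresponding unit eigenvectors $v_\pm$. For $g:\mathbb T^2\to\mathbb R$ and $\alpha\in(0,1]$ set $|g|_\alpha^\pm=\sup_{\psi}\sup_{x\in\mathbb R\setminus\{0\}}|g(\psi+xv_\pm)-g(\psi)|/|x|^\alpha$. $\mathfrak B^*_{\alpha_-,\alpha_+}(\mathbb T^2,\mathbb R)$ is the Banach space of bounded continuous $g$ with $\|g\|_\infty+\alpha_-|g|^-_{\alpha_-}+\alpha_+|g|^+_{\alpha_+}<\infty$. For $g$ on $\Omega$ set $|g|_\alpha=\sup|g(\varphi,\psi')-g(\varphi,\psi)|/|\psi'-\psi|^\alpha$ over $(\varphi,\psi)\neq(\varphi,\psi')\in\Omega$. For $k\ge1$, $\mathscr B_{\alpha,k}(\Omega,\mathbb R)$ is the Banach space of functions $k$ times continuously differentiable in $\varphi$ with $\sum_{n=0}^k\|\partial_\varphi^ng\|_\infty+\alpha\sum_{n=0}^{k-1}|\partial^n_\varphi g|_\alpha<\infty$; the same definition applies with $\mathbb T\times\mathbb T^2$ in place of $\Omega$. $F\in\mathscr B_{\alpha_0,6}(\mathbb T\times\mathbb T^2,\mathbb R)$ for some $\alpha_0\in(0,1]$. Hypothesis 1: there is a non-empty closed interval $\mathcal U=[\phi_m,\phi_M]\subsetneq\mathbb T$, $\phi_m<\phi_M$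 (identified with an interval of $\mathbb R$), such that, with $\Omega=\mathcal U\times\mathbb T^2$, $1+\partial_\varphi F>0$ on $\Omega$, and $F(\phi_m,\psi)>0$, $F(\phi_M,\psi)<0$ for all $\psi$. Hypothesis 2: for every $\psi$ there is a unique $S(\psi)\in\operatorname{int}\mathcal U$ with $F(S(\psi),\psi)=0$. Set $S_m=\inf_\psi S$, $S_M=\sup_\psi S$, $\Lambda=[S_m,S_M]\times\mathbb T^2$, $\Gamma=-\sup_\Lambda\partial_\varphi F$. Hypothesis 3: $\Gamma>0$. Under these hypotheses $\mathcal S$ maps $\Omega$ into itself, and there is a unique $W:\mathbb T^2\to\mathbb R$ with graph contained in $\Lambda$ and $\mathcal S(W(\psi),\psi)=(W(A_0\psi),A_0\psi)$ for all $\psi$; it belongs to $\mathfrak B^*_{\alpha_-,\alpha_+}(\mathbb T^2,\mathbb R)$ for suitable $\alpha_-,\alpha_+\in(0,\alpha_0]$. *)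

theory Defs
  imports "HOL-Analysis.Analysis"
begin

text \<open>
  Functions on the torus \<open>T\<^sup>2 = (R / 2 \<pi> Z)\<^sup>2\<close> are represented by their lifts, i.e. by
  \<open>2 \<pi> Z\<^sup>2\<close>-periodic functions on \<open>real ^ 2\<close>, and subsets of \<open>R \<times> T\<^sup>2\<close> by their preimages in
  \<open>real \<times> (real ^ 2)\<close>, which are \<open>2 \<pi> Z\<^sup>2\<close>-saturated.  A function of \<open>(\<phi>, \<psi>)\<close> is curried,
  and the variable \<open>\<phi>\<close> ranges over a set \<open>I\<close> of reals: an interval, or \<open>UNIV\<close> for lifts of
  functions of \<open>\<phi> \<in> T\<close>.
\<close>

definition lattice_vec :: "real ^ 2 \<Rightarrow> bool" where
  "lattice_vec p \<longleftrightarrow> (\<exists>m :: int ^ 2. p = (\<chi> i. 2 * pi * of_int (m $ i)))"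

definition periodic2 :: "(real ^ 2 \<Rightarrow> 'b) \<Rightarrow> bool" where
  "periodic2 g \<longleftrightarrow> (\<forall>\<psi> p. lattice_vec p \<longrightarrow> g (\<psi> + p) = g \<psi>)"

definition saturated :: "(real \<times> (real ^ 2)) set \<Rightarrow> bool" where
  "saturated X \<longleftrightarrow> (\<forall>\<eta> \<psi> p. lattice_vec p \<longrightarrow> (\<eta>, \<psi>) \<in> X \<longrightarrow> (\<eta>, \<psi> + p) \<in> X)"

definition anosov_automorphism :: "real ^ 2 ^ 2 \<Rightarrow> bool" where
  "anosov_automorphism A \<longleftrightarrow>
     (\<forall>i j. A $ i $ j \<in> \<int>) \<and> \<bar>det A\<bar> = 1 \<and>
     (\<forall>z :: complex. det (map_matrix complex_of_real A - mat z) = 0 \<longrightarrow> cmod z \<noteq> 1)"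

definition dir_seminorm :: "real ^ 2 \<Rightarrow> real \<Rightarrow> (real ^ 2 \<Rightarrow> real) \<Rightarrow> ennreal" where
  "dir_seminorm v \<alpha> g =
     (SUP (\<psi>, x) \<in> UNIV \<times> (UNIV - {0 :: real}).
        ennreal (\<bar>g (\<psi> + x *\<^sub>R v) - g \<psi>\<bar> / \<bar>x\<bar> powr \<alpha>))"

definition Bstar :: "real ^ 2 \<Rightarrow> real ^ 2 \<Rightarrow> real \<Rightarrow> real \<Rightarrow> (real ^ 2 \<Rightarrow> real) set" where
  "Bstar vm vp \<alpha>m \<alpha>p =
     {g. periodic2 g \<and> continuous_on UNIV g \<and>
         (SUP \<psi>. ennreal \<bar>g \<psi>\<bar>) + ennreal \<alpha>m * dir_seminorm vm \<alpha>m g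
           + ennreal \<alpha>p * dir_seminorm vp \<alpha>p g < \<infinity>}"

text \<open>
  The partial derivative in \<open>\<phi>\<close>; it is one-sided at the end points if \<open>I\<close> is a closed interval.
\<close>

definition dphi :: "real set \<Rightarrow> (real \<Rightarrow> real ^ 2 \<Rightarrow> real) \<Rightarrow> real \<Rightarrow> real ^ 2 \<Rightarrow> real" where
  "dphi I g \<phi> \<psi> = vector_derivative (\<lambda>x. g x \<psi>) (at \<phi> within I)"

definition sup_norm :: "real set \<Rightarrow> (real \<Rightarrow> real ^ 2 \<Rightarrow> real) \<Rightarrow> ennreal" where
  "sup_norm I g = (SUP (\<phi>, \<psi>) \<in> I \<times> UNIV. ennreal \<bar>g \<phi> \<psi>\<bar>)"

text \<open>
  For functions that are periodic in \<open>\<psi>\<close>, the supremum over pairs of lifts with the Euclidean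
  distance is the supremum over pairs of points of the torus with the torus distance, which is
  the minimal distance between lifts.
\<close>

definition hoelder_seminorm :: "real set \<Rightarrow> real \<Rightarrow> (real \<Rightarrow> real ^ 2 \<Rightarrow> real) \<Rightarrow> ennreal" where
  "hoelder_seminorm I \<alpha> g =
     (SUP (\<phi>, \<psi>, \<psi>') \<in> {(\<phi>, \<psi>, \<psi>'). \<phi> \<in> I \<and> \<psi> \<noteq> \<psi>'}.
        ennreal (\<bar>g \<phi> \<psi>' - g \<phi> \<psi>\<bar> / norm (\<psi>' - \<psi>) powr \<alpha>))"

text \<open>
  The space \<open>B\<close> with exponent \<open>\<alpha>\<close> and order \<open>k\<close> over \<open>I \<times> T\<^sup>2\<close>.  Values of \<open>g\<close> outside
  \<open>I\<close> play no role.
\<close>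

definition Bspace :: "real \<Rightarrow> nat \<Rightarrow> real set \<Rightarrow> (real \<Rightarrow> real ^ 2 \<Rightarrow> real) set" where
  "Bspace \<alpha> k I =
     {g. (\<forall>\<phi>\<in>I. periodic2 (g \<phi>)) \<and>
         (\<forall>n<k. \<forall>\<psi>. \<forall>\<phi>\<in>I. (\<lambda>x. (dphi I ^^ n) g x \<psi>) differentiable (at \<phi> within I)) \<and>
         (\<forall>\<psi>. continuous_on I (\<lambda>x. (dphi I ^^ k) g x \<psi>)) \<and>
         (\<Sum>n\<le>k. sup_norm I ((dphi I ^^ n) g))
           + ennreal \<alpha> * (\<Sum>n<k. hoelder_seminorm I \<alpha> ((dphi I ^^ n) g)) < \<infinity>}"

definition Bspace_torus :: "real \<Rightarrow> nat \<Rightarrow> (real \<Rightarrow> real ^ 2 \<Rightarrow> real) set" where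
  "Bspace_torus \<alpha> k = {g \<in> Bspace \<alpha> k UNIV. \<forall>\<phi> \<psi>. g (\<phi> + 2 * pi) \<psi> = g \<phi> \<psi>}"

text \<open>
  The lift of the skew product.  When \<open>F\<close> points inwards at both ends of an interval \<open>U\<close>, and
  \<open>\<phi> + F\<close> increases in \<open>\<phi>\<close>, the lift itself maps \<open>U \<times> T\<^sup>2\<close> into \<open>U \<times> T\<^sup>2\<close>, so that no reduction
  modulo \<open>2 \<pi>\<close> of the first component is needed there.
\<close>

definition skew ::
  "real ^ 2 ^ 2 \<Rightarrow> (real \<Rightarrow> real ^ 2 \<Rightarrow> real) \<Rightarrow> real \<times> (real ^ 2) \<Rightarrow> real \<times> (real ^ 2)" where
  "skew A F = (\<lambda>(\<phi>, \<psi>). (\<phi> + F \<phi> \<psi>, A *v \<psi>))"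

definition lin_skew ::
  "real ^ 2 ^ 2 \<Rightarrow> (real ^ 2 \<Rightarrow> real) \<Rightarrow> real \<times> (real ^ 2) \<Rightarrow> real \<times> (real ^ 2)" where
  "lin_skew A \<kappa> = (\<lambda>(\<eta>, \<psi>). (\<kappa> \<psi> * \<eta>, A *v \<psi>))"

end

theory Submission
  imports Defs
begin

text \<open>
  Write \<open>G = \<phi> + F\<close> and let \<open>(\<phi>\<^sub>n, \<psi>\<^sub>n)\<close> be the orbit of \<open>(\<phi>, \<psi>)\<close>.  The conjugacy is the
  Koenigs linearization along the fibres: \<open>h\<close> is the primitive in \<open>\<phi>\<close>, vanishing on the graph of
  \<open>W\<close>, of \<open>exp (\<Sum>n. ln (G' (\<phi>\<^sub>n, \<psi>\<^sub>n)) - ln (G' (W \<psi>\<^sub>n, \<psi>\<^sub>n)))\<close>.  Every orbit enters, after a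
  uniformly bounded time, a neighbourhood of \<open>\<Lambda>\<close> on which \<open>G' \<le> \<rho> < 1\<close>, so the \<open>n\<close>-th term is at
  most \<open>C \<rho>\<^sup>n\<close>.  In \<open>\<psi>\<close> it is \<open>\<beta>\<close>-Hoelder with a constant of size \<open>Q\<^sup>n\<close>, where \<open>Q\<close> may be large.
  Interpolating between the two bounds with weights \<open>1 - \<theta>\<close> and \<open>\<theta>\<close> gives a convergent series of
  \<open>\<theta> \<beta>\<close>-Hoelder terms as soon as \<open>\<theta>\<close> is so small that \<open>\<rho> powr (1 - \<theta>) * Q powr \<theta> < 1\<close>.
\<close>

section \<open>Linearization of a fibrewise attracting skew product\<close>

lemma interpolate_min:
  fixes x u v :: real
  assumes "0 \<le> x" "x \<le> u" "x \<le> v" "0 \<le> \<theta>" "\<theta> \<le> 1"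
  shows "x \<le> u powr (1 - \<theta>) * v powr \<theta>"
proof (cases "x = 0")
  case False
  then have "x = x powr (1 - \<theta>) * x powr \<theta>"
    using assms(1) by (simp add: powr_add [symmetric])
  also have "\<dots> \<le> u powr (1 - \<theta>) * v powr \<theta>"
    using assms by (intro mult_mono powr_mono2) auto
  finally show ?thesis .
qed simp

text \<open>For \<open>d \<le> 1\<close> a smaller exponent gives a larger power; beyond that the
  uniform bound \<open>D\<close> takes over. This brings Hoelder estimates with different exponents
  to a common one.\<close>

lemma hoelder_exponent_mono:
  fixes x d :: real
  assumes "\<bar>x\<bar> \<le> C * d powr \<alpha>" "\<bar>x\<bar> \<le> D" "0 \<le> C" "0 \<le> d" "0 < \<beta>" "\<beta> \<le> \<alpha>"
  shows "\<bar>x\<bar> \<le> max C D * d powr \<beta>"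
proof (cases "d \<le> 1")
  case True
  have "\<bar>x\<bar> \<le> C * d powr \<alpha>"
    by fact
  also have "\<dots> \<le> max C D * d powr \<beta>"
    using True assms by (intro mult_mono powr_mono') auto
  finally show ?thesis .
next
  case False
  have "D * 1 \<le> max C D * d powr \<beta>"
    using False assms by (intro mult_mono ge_one_powr_ge_zero) auto
  with assms show ?thesis
    by simp
qed

text \<open>The product is continuous in \<theta> and equals \<rho> at \<theta> = 0, however large
  \<open>Q\<close> is.\<close>

lemma ex_contracting_exponent:
  fixes \<rho> Q :: real
  assumes "0 < \<rho>" "\<rho> < 1" "0 < Q"
  shows "\<exists>\<theta>. 0 < \<theta> \<and> \<theta> \<le> 1 \<and> \<rho> powr (1 - \<theta>) * Q powr \<theta> < 1"
proof -
  have "((\<lambda>\<theta>. \<rho> powr (1 - \<theta>) * Q powr \<theta>) \<longlongrightarrow> \<rho> powr (1 - 0) * Q powr 0) (at_right 0)"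
    using assms by (intro tendsto_intros) auto
  then have "\<forall>\<^sub>F \<theta> in at_right 0. \<rho> powr (1 - \<theta>) * Q powr \<theta> < 1"
    using assms by (intro order_tendstoD) auto
  moreover have "\<forall>\<^sub>F \<theta> in at_right (0::real). 0 < \<theta> \<and> \<theta> < 1"
    by (simp add: eventually_at_right_less eventually_conj order_tendstoD eventually_at_right_real
        eventually_conj_iff) (auto simp: eventually_at_right_field intro: exI [of _ 1])
  ultimately have "\<forall>\<^sub>F \<theta> in at_right 0. \<rho> powr (1 - \<theta>) * Q powr \<theta> < 1 \<and> 0 < \<theta> \<and> \<theta> < 1"
    by eventually_elim auto
  then show ?thesis
    by (metis (mono_tags, lifting) eventually_happens trivial_limit_at_right_real less_imp_le)
qed

lemma abs_ln_diff_le: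
  fixes u v c :: real
  assumes "0 < c" "c \<le> u" "c \<le> v"
  shows "\<bar>ln u - ln v\<bar> \<le> \<bar>u - v\<bar> / c"
proof -
  have *: "ln x - ln y \<le> \<bar>x - y\<bar> / c" if "c \<le> x" "c \<le> y" for x y :: real
  proof -
    have "ln x - ln y \<le> (x - y) / y"
      using that assms ln_diff_le by simp
    also have "\<dots> \<le> \<bar>x - y\<bar> / c"
      using that assms by (intro frac_le) auto
    finally show ?thesis .
  qed
  show ?thesis
    using * [of u v] * [of v u] assms by (simp add: abs_le_iff abs_minus_commute)
qed

text \<open>The first component of the \<open>n\<close>-th iterate of the skew product with fibre
  map \<open>G\<close> over \<open>T\<close>; the second component is
  \<open>(T ^^ n) y\<close>.\<close>

primrec fibre_orbit :: "(real \<Rightarrow> 'a \<Rightarrow> real) \<Rightarrow> ('a \<Rightarrow> 'a) \<Rightarrow> nat \<Rightarrow> real \<Rightarrow> 'a \<Rightarrow> real" where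
  "fibre_orbit G T 0 x y = x"
| "fibre_orbit G T (Suc n) x y = G (fibre_orbit G T n x y) ((T ^^ n) y)"

text \<open>The recursion adds a step at the end of the orbit, whereas the functional equation needs
  one removed at its start.\<close>

lemma fibre_orbit_shift: "fibre_orbit G T n (G x y) (T y) = fibre_orbit G T (Suc n) x y"
  by (induction n) (simp_all add: funpow_swap1)

text \<open>With congruence modulo the lattice as \<open>R\<close>, this is the source of the
  periodicity of the linearization.\<close>

lemma fibre_orbit_cong_rel:
  assumes "\<And>y y'. R y y' \<Longrightarrow> R (T y) (T y')" "\<And>x y y'. R y y' \<Longrightarrow> G x y = G x y'" "R y y'"
  shows "R ((T ^^ n) y) ((T ^^ n) y')" "fibre_orbit G T n x y = fibre_orbit G T n x y'"
proof -
  show R: "R ((T ^^ n) y) ((T ^^ n) y')" for n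
    by (induction n) (use assms in auto)
  show "fibre_orbit G T n x y = fibre_orbit G T n x y'"
    by (induction n) (use assms(2) [OF R] in auto)
qed

text \<open>A single constant \<open>K\<close> serves for all upper bounds. Contraction is assumed
  only from time \<open>N\<close> on, uniformly in the starting point, because \<open>G1\<close> may
  exceed 1 in parts of the interval.\<close>

locale attracting_skew_product =
  fixes T :: "'a :: metric_space \<Rightarrow> 'a" and G G1 G2 :: "real \<Rightarrow> 'a \<Rightarrow> real"
    and a b :: real and W :: "'a \<Rightarrow> real" and K c \<beta> \<rho> :: real and N :: nat
  assumes ab: "a < b"
    and maps: "\<And>x y. x \<in> {a..b} \<Longrightarrow> G x y \<in> {a..b}"
    and deriv_G: "\<And>x y. x \<in> {a..b} \<Longrightarrow>
      ((\<lambda>x. G x y) has_real_derivative G1 x y) (at x within {a..b})"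
    and deriv_G1: "\<And>x y. x \<in> {a..b} \<Longrightarrow>
      ((\<lambda>x. G1 x y) has_real_derivative G2 x y) (at x within {a..b})"
    and cont_G2: "\<And>y. continuous_on {a..b} (\<lambda>x. G2 x y)"
    and c: "0 < c" and K: "1 \<le> K" and \<beta>: "0 < \<beta>" "\<beta> \<le> 1" and \<rho>: "0 < \<rho>" "\<rho> < 1"
    and G1_bounds: "\<And>x y. x \<in> {a..b} \<Longrightarrow> c \<le> G1 x y" "\<And>x y. x \<in> {a..b} \<Longrightarrow> G1 x y \<le> K"
    and G2_bound: "\<And>x y. x \<in> {a..b} \<Longrightarrow> \<bar>G2 x y\<bar> \<le> K"
    and hoelder_G: "\<And>x y y'. x \<in> {a..b} \<Longrightarrow> \<bar>G x y - G x y'\<bar> \<le> K * dist y y' powr \<beta>"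
    and hoelder_G1: "\<And>x y y'. x \<in> {a..b} \<Longrightarrow> \<bar>G1 x y - G1 x y'\<bar> \<le> K * dist y y' powr \<beta>"
    and hoelder_W: "\<And>y y'. \<bar>W y - W y'\<bar> \<le> K * dist y y' powr \<beta>"
    and lipschitz_T: "\<And>y y'. dist (T y) (T y') \<le> K * dist y y'"
    and W_in: "\<And>y. W y \<in> {a..b}"
    and W_invariant: "\<And>y. G (W y) y = W (T y)"
    and contracts: "\<And>n x y. x \<in> {a..b} \<Longrightarrow> N \<le> n \<Longrightarrow> G1 (fibre_orbit G T n x y) ((T ^^ n) y) \<le> \<rho>"
begin

abbreviation "orbit \<equiv> fibre_orbit G T"

definition "orbit_deriv n x y = (\<Prod>i<n. G1 (orbit i x y) ((T ^^ i) y))"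
definition "log_ratio n x y =
  ln (G1 (orbit n x y) ((T ^^ n) y)) - ln (G1 (W ((T ^^ n) y)) ((T ^^ n) y))"
definition "log_ratio_deriv n x y =
  G2 (orbit n x y) ((T ^^ n) y) / G1 (orbit n x y) ((T ^^ n) y) * orbit_deriv n x y"
definition "log_slope x y = (\<Sum>n. log_ratio n x y)"
definition "log_slope_deriv x y = (\<Sum>n. log_ratio_deriv n x y)"
definition "slope x y = exp (log_slope x y)"
text \<open>Both integrals start at \<open>a\<close> because the integral over
  \<open>{W y..x}\<close> would be 0, without the sign of an oriented integral, for
  \<open>x < W y\<close>.\<close>

definition "linearization x y =
  integral {a..x} (\<lambda>s. slope s y) - integral {a..W y} (\<lambda>s. slope s y)"
text \<open>The price of the first \<open>N\<close> steps, in which a factor is bounded by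
  \<open>K\<close> instead of \<rho>.\<close>

definition "orbit_const = (K / \<rho>) ^ N"

section \<open>Contraction of orbits towards the graph of \<open>W\<close>\<close>

lemma orbit_in: "x \<in> {a..b} \<Longrightarrow> orbit n x y \<in> {a..b}"
  by (induction n) (simp_all add: maps del: atLeastAtMost_iff)

lemma orbit_W: "orbit n (W y) y = W ((T ^^ n) y)"
  by (induction n) (simp_all add: W_invariant)

lemma has_derivative_orbit:
  assumes "x \<in> {a..b}"
  shows "((\<lambda>x. orbit n x y) has_real_derivative orbit_deriv n x y) (at x within {a..b})"
proof (induction n)
  case (Suc n)
  have "(\<lambda>x. orbit n x y) ` {a..b} \<subseteq> {a..b}"
    using orbit_in by blast
  from DERIV_image_chain [OF DERIV_subset [OF deriv_G [OF orbit_in [OF assms]] this] Suc]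
  show ?case
    by (simp add: o_def orbit_deriv_def mult.commute)
qed (simp add: orbit_deriv_def)

lemma orbit_deriv_nonneg: "x \<in> {a..b} \<Longrightarrow> 0 \<le> orbit_deriv n x y"
  unfolding orbit_deriv_def using G1_bounds(1) [OF orbit_in] c
  by (intro prod_nonneg ballI) (meson less_le_trans less_imp_le)

lemma orbit_const_nonneg: "0 \<le> orbit_const"
  using K \<rho> by (simp add: orbit_const_def)

lemma orbit_deriv_le:
  assumes "x \<in> {a..b}"
  shows "orbit_deriv n x y \<le> orbit_const * \<rho> ^ n"
proof -
  have K\<rho>: "1 \<le> K / \<rho>"
    using K \<rho> by simp
  \<comment> \<open>The exponent \<open>min n N\<close> counts the early factors met so far, each
    exceeding \<rho> by at most the ratio \<open>K / \<rho>\<close>. Since this ratio is at least 1,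
    the exponent can be raised to \<open>N\<close> at the end.\<close>
  have "orbit_deriv n x y \<le> (K / \<rho>) ^ min n N * \<rho> ^ n"
  proof (induction n)
    case (Suc n)
    have nonneg: "0 \<le> G1 (orbit n x y) ((T ^^ n) y)"
      using G1_bounds(1) [OF orbit_in [OF assms]] c by (meson less_le_trans less_imp_le)
    have "orbit_deriv (Suc n) x y = orbit_deriv n x y * G1 (orbit n x y) ((T ^^ n) y)"
      by (simp add: orbit_deriv_def)
    also have "\<dots> \<le> (K / \<rho>) ^ min (Suc n) N * \<rho> ^ Suc n"
    proof (cases "N \<le> n")
      case True
      have "orbit_deriv n x y * G1 (orbit n x y) ((T ^^ n) y) \<le> ((K / \<rho>) ^ min n N * \<rho> ^ n) * \<rho>"
        using Suc contracts [OF assms True] nonneg K \<rho>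
        by (intro mult_mono) auto
      then show ?thesis
        using True by (simp add: min.absorb2 mult_ac)
    next
      case False
      have "orbit_deriv n x y * G1 (orbit n x y) ((T ^^ n) y) \<le> ((K / \<rho>) ^ min n N * \<rho> ^ n) * K"
        using Suc G1_bounds(2) [OF orbit_in [OF assms]] nonneg K \<rho>
        by (intro mult_mono) auto
      then show ?thesis
        using False \<rho> by (simp add: min_def field_simps)
    qed
    finally show ?case .
  qed (simp add: orbit_deriv_def)
  also have "\<dots> \<le> orbit_const * \<rho> ^ n"
    unfolding orbit_const_def using K\<rho> \<rho> by (intro mult_right_mono power_increasing) auto
  finally show ?thesis .
qed

text \<open>The point \<open>W y\<close> lies on the same fibre and its orbit stays on the graph, so
  the mean value theorem compares the two orbits.\<close>

lemma orbit_dist_W: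
  assumes "x \<in> {a..b}"
  shows "\<bar>orbit n x y - W ((T ^^ n) y)\<bar> \<le> orbit_const * \<rho> ^ n * (b - a)"
proof -
  have "norm (orbit n x y - orbit n (W y) y) \<le> orbit_const * \<rho> ^ n * norm (x - W y)"
    by (rule field_differentiable_bound [OF convex_real_interval(5) has_derivative_orbit])
      (use assms W_in orbit_deriv_le orbit_deriv_nonneg in auto)
  also have "\<dots> \<le> orbit_const * \<rho> ^ n * (b - a)"
    using assms W_in [of y] orbit_const_nonneg \<rho> by (intro mult_left_mono) auto
  finally show ?thesis
    by (simp add: orbit_W)
qed

section \<open>Dependence of orbits on the base point\<close>

lemma G1_diff:
  assumes "x \<in> {a..b}" "x' \<in> {a..b}"
  shows "\<bar>G1 x y - G1 x' y'\<bar> \<le> K * (\<bar>x - x'\<bar> + dist y y' powr \<beta>)"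
proof -
  have "norm (G1 x y - G1 x' y) \<le> K * norm (x - x')"
    by (rule field_differentiable_bound [OF convex_real_interval(5) deriv_G1])
      (use assms G2_bound in auto)
  then show ?thesis
    using hoelder_G1 [OF assms(2), of y y'] by (simp add: distrib_left)
qed

lemma G_diff:
  assumes "x \<in> {a..b}" "x' \<in> {a..b}"
  shows "\<bar>G x y - G x' y'\<bar> \<le> K * (\<bar>x - x'\<bar> + dist y y' powr \<beta>)"
proof -
  have "\<bar>G1 x y\<bar> \<le> K" if "x \<in> {a..b}" for x
    using G1_bounds [OF that, of y] c by simp
  then have "norm (G x y - G x' y) \<le> K * norm (x - x')"
    by (intro field_differentiable_bound [OF convex_real_interval(5) deriv_G])
      (use assms in auto)
  then show ?thesis
    using hoelder_G [OF assms(2), of y y'] by (simp add: distrib_left)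
qed

lemma ln_G1_diff:
  assumes "x \<in> {a..b}" "x' \<in> {a..b}"
  shows "\<bar>ln (G1 x y) - ln (G1 x' y')\<bar> \<le> K / c * (\<bar>x - x'\<bar> + dist y y' powr \<beta>)"
proof -
  have "\<bar>ln (G1 x y) - ln (G1 x' y')\<bar> \<le> \<bar>G1 x y - G1 x' y'\<bar> / c"
    using c G1_bounds(1) assms by (intro abs_ln_diff_le) auto
  also have "\<dots> \<le> K * (\<bar>x - x'\<bar> + dist y y' powr \<beta>) / c"
    using G1_diff [OF assms] c by (intro divide_right_mono) auto
  finally show ?thesis
    by simp
qed

text \<open>\<open>T\<close> may expand, so a factor \<open>K ^ n\<close> appears; its power \<beta>
  is at most the factor itself because \<open>1 \<le> K\<close> and
  \<open>\<beta> \<le> 1\<close>.\<close>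

lemma dist_funpow_T: "dist ((T ^^ n) y) ((T ^^ n) y') powr \<beta> \<le> K ^ n * dist y y' powr \<beta>"
proof -
  have "dist ((T ^^ n) y) ((T ^^ n) y') \<le> K ^ n * dist y y'"
  proof (induction n)
    case (Suc n)
    have "dist ((T ^^ Suc n) y) ((T ^^ Suc n) y') \<le> K * dist ((T ^^ n) y) ((T ^^ n) y')"
      using lipschitz_T by simp
    also have "\<dots> \<le> K * (K ^ n * dist y y')"
      using Suc K by (intro mult_left_mono) auto
    finally show ?case
      by (simp add: mult.assoc)
  qed simp
  then have "dist ((T ^^ n) y) ((T ^^ n) y') powr \<beta> \<le> (K ^ n * dist y y') powr \<beta>"
    using \<beta> by (intro powr_mono2) auto
  also have "\<dots> = (K ^ n) powr \<beta> * dist y y' powr \<beta>"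
    using K by (simp add: powr_mult)
  also have "(K ^ n) powr \<beta> \<le> (K ^ n) powr 1"
    using K \<beta> by (intro powr_mono) auto
  finally show ?thesis
    using K by (simp add: mult_right_mono)
qed

text \<open>Each step adds a base point error of at most \<open>K ^ n\<close> to the accumulated one
  and multiplies by \<open>K\<close>. Both errors are below \<open>(2 * K) ^ n\<close>, so
  \<open>2 * K\<close> is the growth rate called \<open>Q\<close> in the outline.\<close>

lemma orbit_diff:
  assumes "x \<in> {a..b}"
  shows "\<bar>orbit n x y - orbit n x y'\<bar> \<le> (2 * K) ^ n * dist y y' powr \<beta>"
proof (induction n)
  case (Suc n)
  have "\<bar>orbit (Suc n) x y - orbit (Suc n) x y'\<bar> \<le>
      K * (\<bar>orbit n x y - orbit n x y'\<bar> + dist ((T ^^ n) y) ((T ^^ n) y') powr \<beta>)"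
    using G_diff orbit_in [OF assms] by simp
  also have "\<dots> \<le> K * ((2 * K) ^ n * dist y y' powr \<beta> + (2 * K) ^ n * dist y y' powr \<beta>)"
  proof (intro mult_left_mono add_mono Suc)
    have "K ^ n * dist y y' powr \<beta> \<le> (2 * K) ^ n * dist y y' powr \<beta>"
      using K by (intro mult_right_mono power_mono) auto
    then show "dist ((T ^^ n) y) ((T ^^ n) y') powr \<beta> \<le> (2 * K) ^ n * dist y y' powr \<beta>"
      using dist_funpow_T [of n y y'] by linarith
  qed (use K in auto)
  finally show ?case
    by (simp add: algebra_simps)
qed simp

section \<open>The two bounds on the terms of the series\<close>

lemma log_ratio_bound:
  assumes "x \<in> {a..b}"
  shows "\<bar>log_ratio n x y\<bar> \<le> K / c * orbit_const * (b - a) * \<rho> ^ n"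
proof -
  \<comment> \<open>The summand 0 is the Hoelder term for two equal base points.\<close>
  have "\<bar>log_ratio n x y\<bar> \<le> K / c * (\<bar>orbit n x y - W ((T ^^ n) y)\<bar> + 0)"
    using ln_G1_diff [OF orbit_in [OF assms, of n y] W_in [of "(T ^^ n) y"], of "(T ^^ n) y" "(T ^^ n) y"]
    by (simp add: log_ratio_def)
  also have "\<dots> \<le> K / c * (orbit_const * \<rho> ^ n * (b - a))"
    using orbit_dist_W [OF assms] K c by (intro mult_left_mono) auto
  finally show ?thesis
    by (simp add: mult_ac)
qed

text \<open>The constant \<open>3 + K\<close> collects 1 from the orbit, \<open>K\<close> from
  \<open>W\<close>, and 1 from the base point in each of the two logarithms.\<close>

lemma log_ratio_diff:
  assumes "x \<in> {a..b}"
  shows "\<bar>log_ratio n x y - log_ratio n x y'\<bar> \<le> K / c * (3 + K) * ((2 * K) ^ n * dist y y' powr \<beta>)"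
proof -
  let ?d = "dist y y' powr \<beta>" and ?u = "(T ^^ n) y" and ?u' = "(T ^^ n) y'"
  have KQ: "K ^ n * ?d \<le> (2 * K) ^ n * ?d"
    using K by (intro mult_right_mono power_mono) auto
  have dT: "dist ?u ?u' powr \<beta> \<le> (2 * K) ^ n * ?d"
    using dist_funpow_T [of n y y'] KQ by linarith
  have "\<bar>W ?u - W ?u'\<bar> \<le> K * dist ?u ?u' powr \<beta>"
    by (rule hoelder_W)
  also have "\<dots> \<le> K * ((2 * K) ^ n * ?d)"
    using K dT by (intro mult_left_mono) auto
  finally have W: "\<bar>W ?u - W ?u'\<bar> \<le> K * ((2 * K) ^ n * ?d)" .
  have "\<bar>log_ratio n x y - log_ratio n x y'\<bar> \<le>
      \<bar>ln (G1 (orbit n x y) ?u) - ln (G1 (orbit n x y') ?u')\<bar> + \<bar>ln (G1 (W ?u) ?u) - ln (G1 (W ?u') ?u')\<bar>"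
    by (simp add: log_ratio_def)
  also have "\<dots> \<le> K / c * (\<bar>orbit n x y - orbit n x y'\<bar> + dist ?u ?u' powr \<beta>)
      + K / c * (\<bar>W ?u - W ?u'\<bar> + dist ?u ?u' powr \<beta>)"
    by (intro add_mono ln_G1_diff orbit_in assms W_in)
  also have "\<dots> = K / c * (\<bar>orbit n x y - orbit n x y'\<bar> + dist ?u ?u' powr \<beta>
      + (\<bar>W ?u - W ?u'\<bar> + dist ?u ?u' powr \<beta>))"
    by (simp add: algebra_simps)
  also have "\<dots> \<le> K / c * ((2 * K) ^ n * ?d + (2 * K) ^ n * ?d + (K * ((2 * K) ^ n * ?d) + (2 * K) ^ n * ?d))"
    using K c by (intro mult_left_mono add_mono dT W orbit_diff assms) auto
  finally show ?thesis
    by (simp add: algebra_simps)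
qed

section \<open>Convergence and termwise differentiation of the series\<close>

lemma summable_geometric_\<rho>: "summable (\<lambda>n. C * \<rho> ^ n)"
  using \<rho> by (intro summable_mult summable_geometric) auto

lemma summable_log_ratio: "x \<in> {a..b} \<Longrightarrow> summable (\<lambda>n. log_ratio n x y)"
  using log_ratio_bound [of x]
  by (intro summable_comparison_test' [OF summable_geometric_\<rho>, of 0 _ "K / c * orbit_const * (b - a)"])
    (auto simp del: times_divide_eq_left)

lemma log_slope_bound:
  assumes "x \<in> {a..b}"
  shows "\<bar>log_slope x y\<bar> \<le> (\<Sum>n. K / c * orbit_const * (b - a) * \<rho> ^ n)"
  unfolding log_slope_def
  using norm_suminf_le [OF _ summable_geometric_\<rho>, of "\<lambda>n. log_ratio n x y"] log_ratio_bound [OF assms]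
  by (metis real_norm_def)

text \<open>The second logarithm in \<open>log_ratio\<close> is constant along the fibre, so only
  the first contributes.\<close>

lemma has_derivative_log_ratio:
  assumes "x \<in> {a..b}"
  shows "((\<lambda>x. log_ratio n x y) has_real_derivative log_ratio_deriv n x y) (at x within {a..b})"
proof -
  have "(\<lambda>x. orbit n x y) ` {a..b} \<subseteq> {a..b}"
    using orbit_in by blast
  from DERIV_image_chain [OF DERIV_subset [OF deriv_G1 [OF orbit_in [OF assms]] this]
      has_derivative_orbit [OF assms]]
  have "((\<lambda>x. G1 (orbit n x y) ((T ^^ n) y)) has_real_derivative
      G2 (orbit n x y) ((T ^^ n) y) * orbit_deriv n x y) (at x within {a..b})"
    by (simp add: o_def)
  moreover have "0 < G1 (orbit n x y) ((T ^^ n) y)"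
    using G1_bounds(1) [OF orbit_in [OF assms]] c by (meson less_le_trans)
  ultimately show ?thesis
    unfolding log_ratio_def log_ratio_deriv_def
    by (auto intro!: derivative_eq_intros)
qed

text \<open>The decay comes from the factor \<open>orbit_deriv\<close>; the quotient is merely
  bounded.\<close>

lemma log_ratio_deriv_bound:
  assumes "x \<in> {a..b}"
  shows "\<bar>log_ratio_deriv n x y\<bar> \<le> K / c * orbit_const * \<rho> ^ n"
proof -
  have "\<bar>log_ratio_deriv n x y\<bar> = \<bar>G2 (orbit n x y) ((T ^^ n) y)\<bar> / \<bar>G1 (orbit n x y) ((T ^^ n) y)\<bar>
      * \<bar>orbit_deriv n x y\<bar>"
    by (simp add: log_ratio_deriv_def abs_mult abs_divide)
  also have "\<dots> \<le> K / c * (orbit_const * \<rho> ^ n)"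
    using G1_bounds(1) [OF orbit_in [OF assms, of n y], of "(T ^^ n) y"]
      G2_bound [OF orbit_in [OF assms, of n y], of "(T ^^ n) y"] K c
      orbit_deriv_le [OF assms] orbit_deriv_nonneg [OF assms]
    by (intro mult_mono frac_le) auto
  finally show ?thesis
    by (simp add: mult.assoc)
qed

lemma continuous_on_log_ratio_deriv: "continuous_on {a..b} (\<lambda>x. log_ratio_deriv n x y)"
proof -
  have orb: "continuous_on {a..b} (\<lambda>x. orbit n x y)" for n
    using has_derivative_orbit by (intro DERIV_continuous_on)
  have G1: "continuous_on {a..b} (\<lambda>x. G1 (orbit n x y) z)" for n z
    by (rule continuous_on_compose2 [OF DERIV_continuous_on [OF deriv_G1] orb]) (use orbit_in in auto)
  have G2: "continuous_on {a..b} (\<lambda>x. G2 (orbit n x y) z)" for n z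
    by (rule continuous_on_compose2 [OF cont_G2 orb]) (use orbit_in in auto)
  have "G1 (orbit n x y) ((T ^^ n) y) \<noteq> 0" if "x \<in> {a..b}" for x
    using G1_bounds(1) [OF orbit_in [OF that, of n y], of "(T ^^ n) y"] c by auto
  then show ?thesis
    unfolding log_ratio_deriv_def orbit_deriv_def
    by (intro continuous_intros G1 G2) auto
qed

lemma uniform_limit_log_slope_deriv:
  "uniform_limit {a..b} (\<lambda>n x. \<Sum>i<n. log_ratio_deriv i x y) (\<lambda>x. log_slope_deriv x y) sequentially"
  unfolding log_slope_deriv_def
  by (rule Weierstrass_m_test [OF _ summable_geometric_\<rho>, of _ _ "K / c * orbit_const"])
    (simp only: real_norm_def log_ratio_deriv_bound)

lemma continuous_on_log_slope_deriv: "continuous_on {a..b} (\<lambda>x. log_slope_deriv x y)"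
  by (rule uniform_limit_theorem [OF _ uniform_limit_log_slope_deriv])
    (auto intro!: continuous_intros continuous_on_log_ratio_deriv always_eventually)

lemma log_slope_deriv_bound:
  assumes "x \<in> {a..b}"
  shows "\<bar>log_slope_deriv x y\<bar> \<le> (\<Sum>n. K / c * orbit_const * \<rho> ^ n)"
  unfolding log_slope_deriv_def
  using norm_suminf_le [OF _ summable_geometric_\<rho>, of "\<lambda>n. log_ratio_deriv n x y"]
    log_ratio_deriv_bound [OF assms]
  by (metis real_norm_def)

lemma has_derivative_log_slope:
  assumes "x \<in> {a..b}"
  shows "((\<lambda>x. log_slope x y) has_real_derivative log_slope_deriv x y) (at x within {a..b})"
proof -
  \<comment> \<open>Besides uniform convergence of the derivatives, termwise differentiation needs
    convergence at one point, for which \<open>W y\<close> is taken.\<close>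
  obtain g where g: "\<And>x. x \<in> {a..b} \<Longrightarrow> (\<lambda>n. log_ratio n x y) sums g x"
    "\<And>x. x \<in> {a..b} \<Longrightarrow> (g has_real_derivative log_slope_deriv x y) (at x within {a..b})"
    using has_field_derivative_series [OF convex_real_interval(5) has_derivative_log_ratio
        uniform_limit_log_slope_deriv W_in summable_log_ratio [OF W_in]]
    by blast
  show ?thesis
    by (rule has_field_derivative_transform_within [OF g(2) [OF assms] zero_less_one assms])
      (simp add: log_slope_def sums_unique [OF g(1)])
qed

section \<open>The primitive and its functional equation\<close>

lemma has_derivative_slope:
  assumes "x \<in> {a..b}"
  shows "((\<lambda>x. slope x y) has_real_derivative slope x y * log_slope_deriv x y) (at x within {a..b})"
  unfolding slope_def
  by (rule derivative_eq_intros has_derivative_log_slope assms refl)+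

lemma continuous_on_slope: "continuous_on {a..b} (\<lambda>x. slope x y)"
  by (rule DERIV_continuous_on [OF has_derivative_slope])

lemma has_derivative_linearization:
  assumes "x \<in> {a..b}"
  shows "((\<lambda>x. linearization x y) has_real_derivative slope x y) (at x within {a..b})"
  unfolding linearization_def
  by (rule derivative_eq_intros integral_has_real_derivative continuous_on_slope assms refl)+ simp

lemma log_slope_W: "log_slope (W y) y = 0"
  by (simp add: log_slope_def log_ratio_def orbit_W)

lemma slope_W: "slope (W y) y = 1"
  by (simp add: slope_def log_slope_W)

text \<open>Passing to the image point drops the zeroth term of the series. After exponentiation
  this is the conjugacy equation differentiated along the fibre.\<close>

lemma slope_shift:
  assumes "x \<in> {a..b}"
  shows "slope (G x y) (T y) * G1 x y = G1 (W y) y * slope x y"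
proof -
  have "log_ratio n (G x y) (T y) = log_ratio (Suc n) x y" for n
    by (simp add: log_ratio_def fibre_orbit_shift funpow_swap1 del: fibre_orbit.simps)
  then have "log_slope x y = log_ratio 0 x y + log_slope (G x y) (T y)"
    using suminf_split_head [OF summable_log_ratio [OF assms]] by (simp add: log_slope_def)
  moreover have "0 < G1 x y" "0 < G1 (W y) y"
    using G1_bounds(1) c assms W_in by (meson less_le_trans)+
  ultimately show ?thesis
    by (simp add: slope_def log_ratio_def exp_add exp_diff)
qed

text \<open>By \<open>slope_shift\<close> the difference of the two sides has derivative 0 along the
  fibre, and it vanishes at \<open>W y\<close> because the graph is invariant.\<close>

lemma linearization_skew:
  assumes "x \<in> {a..b}"
  shows "linearization (G x y) (T y) = G1 (W y) y * linearization x y"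
proof -
  have img: "(\<lambda>x. G x y) ` {a..b} \<subseteq> {a..b}"
    using maps by blast
  define f where "f x = linearization (G x y) (T y) - G1 (W y) y * linearization x y" for x
  have "(f has_real_derivative 0) (at x within {a..b})" if "x \<in> {a..b}" for x
    using DERIV_image_chain [OF DERIV_subset [OF has_derivative_linearization [OF maps [OF that]] img]
        deriv_G [OF that], of "T y"]
    unfolding f_def [abs_def]
    by (auto intro!: derivative_eq_intros has_derivative_linearization that simp: o_def slope_shift [OF that])
  then have "f x = f (W y)"
    using has_field_derivative_zero_constant [OF convex_real_interval(5), of a b f] assms W_in
    by metis
  also have "f (W y) = 0"
    by (simp add: f_def W_invariant linearization_def)
  finally show ?thesis
    by (simp add: f_def)
qed

section \<open>Uniform bounds and Hoelder continuity in the base point\<close>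

definition "slope_bound = exp (\<Sum>n. K / c * orbit_const * (b - a) * \<rho> ^ n)"

lemma slope_le: "x \<in> {a..b} \<Longrightarrow> \<bar>slope x y\<bar> \<le> slope_bound"
  using log_slope_bound [of x y] by (simp add: slope_def slope_bound_def)

lemma linearization_lipschitz:
  assumes "x \<in> {a..b}" "x' \<in> {a..b}"
  shows "\<bar>linearization x y - linearization x' y\<bar> \<le> slope_bound * \<bar>x - x'\<bar>"
proof -
  have "norm (linearization x y - linearization x' y) \<le> slope_bound * norm (x - x')"
    by (rule field_differentiable_bound [OF convex_real_interval(5) has_derivative_linearization])
      (use slope_le assms in auto)
  then show ?thesis
    by simp
qed

lemma linearization_bound:
  assumes "x \<in> {a..b}"
  shows "\<bar>linearization x y\<bar> \<le> slope_bound * (b - a)"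
proof -
  have "\<bar>linearization x y - linearization (W y) y\<bar> \<le> slope_bound * \<bar>x - W y\<bar>"
    by (rule linearization_lipschitz [OF assms W_in])
  also have "\<dots> \<le> slope_bound * (b - a)"
    using assms W_in [of y] by (intro mult_left_mono) (auto simp: slope_bound_def)
  finally show ?thesis
    by (simp add: linearization_def)
qed

lemma slope_deriv_bound:
  assumes "x \<in> {a..b}"
  shows "\<bar>slope x y * log_slope_deriv x y\<bar> \<le> slope_bound * (\<Sum>n. K / c * orbit_const * \<rho> ^ n)"
  unfolding abs_mult
  by (intro mult_mono slope_le log_slope_deriv_bound assms) (auto simp: slope_bound_def)

lemma log_slope_hoelder:
  obtains \<alpha> C where "0 < \<alpha>" "\<alpha> \<le> \<beta>" "0 \<le> C"
    "\<And>x y y'. x \<in> {a..b} \<Longrightarrow> \<bar>log_slope x y - log_slope x y'\<bar> \<le> C * dist y y' powr \<alpha>"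
proof -
  obtain \<theta> where \<theta>: "0 < \<theta>" "\<theta> \<le> 1" "\<rho> powr (1 - \<theta>) * (2 * K) powr \<theta> < 1"
    using ex_contracting_exponent [OF \<rho>, of "2 * K"] K by auto
  define \<sigma> where "\<sigma> = \<rho> powr (1 - \<theta>) * (2 * K) powr \<theta>"
  \<comment> \<open>The factor 2 comes from estimating the difference of two terms by the sum of
    their sizes.\<close>
  define M where "M = max (2 * (K / c * orbit_const * (b - a))) (K / c * (3 + K))"
  have M: "2 * (K / c * orbit_const * (b - a)) \<le> M" "K / c * (3 + K) \<le> M"
    by (auto simp: M_def)
  have "0 \<le> K / c * (3 + K)"
    using K c by simp
  with M have M0: "0 \<le> M"
    by linarith
  have \<sigma>: "0 \<le> \<sigma>" "\<sigma> < 1"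
    using \<theta> by (auto simp: \<sigma>_def)
  have sm: "summable (\<lambda>n. M * dist y y' powr (\<theta> * \<beta>) * \<sigma> ^ n)" for y y' :: 'a
    using \<sigma> by (intro summable_mult summable_geometric) auto
  have pow: "(u ^ n) powr s = (u powr s) ^ n" if "0 < u" for u s :: real and n
    using that by (simp add: powr_realpow [symmetric] powr_powr mult.commute)
  have term_le: "\<bar>log_ratio n x y - log_ratio n x y'\<bar> \<le> M * dist y y' powr (\<theta> * \<beta>) * \<sigma> ^ n"
    if x: "x \<in> {a..b}" for n x y y'
  proof -
    let ?d = "dist y y' powr \<beta>"
    have "\<bar>log_ratio n x y - log_ratio n x y'\<bar> \<le> 2 * (K / c * orbit_const * (b - a)) * \<rho> ^ n"
      using log_ratio_bound [OF x, of n y] log_ratio_bound [OF x, of n y'] by linarith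
    also have "\<dots> \<le> M * \<rho> ^ n"
      using M \<rho> by (intro mult_right_mono) auto
    finally have 1: "\<bar>log_ratio n x y - log_ratio n x y'\<bar> \<le> M * \<rho> ^ n" .
    have "\<bar>log_ratio n x y - log_ratio n x y'\<bar> \<le> K / c * (3 + K) * ((2 * K) ^ n * ?d)"
      by (rule log_ratio_diff [OF x])
    also have "\<dots> \<le> M * ((2 * K) ^ n * ?d)"
      using M K by (intro mult_right_mono) auto
    finally have 2: "\<bar>log_ratio n x y - log_ratio n x y'\<bar> \<le> M * ((2 * K) ^ n * ?d)" .
    \<comment> \<open>Interpolation: the powers of \<open>M\<close> recombine to \<open>M\<close>,
      the distance acquires the exponent \<open>\<theta> * \<beta>\<close>, and the factors
      depending on \<open>n\<close> form \<open>\<sigma> ^ n\<close>.\<close>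
    have "\<bar>log_ratio n x y - log_ratio n x y'\<bar> \<le>
        (M * \<rho> ^ n) powr (1 - \<theta>) * (M * ((2 * K) ^ n * ?d)) powr \<theta>"
      using 1 2 \<theta> by (intro interpolate_min) auto
    also have "\<dots> = (M powr (1 - \<theta>) * M powr \<theta>) * ?d powr \<theta> *
        ((\<rho> ^ n) powr (1 - \<theta>) * ((2 * K) ^ n) powr \<theta>)"
      using M0 \<rho> K by (simp add: powr_mult mult_ac)
    also have "M powr (1 - \<theta>) * M powr \<theta> = M"
      using M0 by (simp add: powr_add [symmetric])
    also have "?d powr \<theta> = dist y y' powr (\<theta> * \<beta>)"
      by (simp add: powr_powr mult.commute)
    also have "(\<rho> ^ n) powr (1 - \<theta>) * ((2 * K) ^ n) powr \<theta> = \<sigma> ^ n"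
      unfolding \<sigma>_def power_mult_distrib [of "\<rho> powr (1 - \<theta>)"]
      using \<rho> K by (subst (1 2) pow) simp_all
    finally show ?thesis .
  qed
  show thesis
  proof
    show "0 < \<theta> * \<beta>" "\<theta> * \<beta> \<le> \<beta>"
      using \<theta> \<beta> by auto
    show "0 \<le> M / (1 - \<sigma>)"
      using M0 \<sigma> by simp
    show "\<bar>log_slope x y - log_slope x y'\<bar> \<le> M / (1 - \<sigma>) * dist y y' powr (\<theta> * \<beta>)"
      if x: "x \<in> {a..b}" for x y y'
    proof -
      have "log_slope x y - log_slope x y' = (\<Sum>n. log_ratio n x y - log_ratio n x y')"
        unfolding log_slope_def by (intro suminf_diff summable_log_ratio x)
      moreover have "norm (\<Sum>n. log_ratio n x y - log_ratio n x y') \<le> (\<Sum>n. M * dist y y' powr (\<theta> * \<beta>) * \<sigma> ^ n)"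
        by (rule norm_suminf_le [OF _ sm]) (use term_le [OF x] in simp)
      moreover have "(\<Sum>n. M * dist y y' powr (\<theta> * \<beta>) * \<sigma> ^ n) = M * dist y y' powr (\<theta> * \<beta>) * (1 / (1 - \<sigma>))"
        using \<sigma> by (subst suminf_mult) (auto simp: suminf_geometric)
      ultimately show ?thesis
        by simp
    qed
  qed
qed

text \<open>The difference of the linearizations over \<open>y\<close> and \<open>y'\<close> has the
  difference of the slopes as derivative, so it remains to control it at the single point
  \<open>W y\<close>.\<close>

lemma linearization_hoelder:
  obtains \<alpha> C where "0 < \<alpha>" "\<alpha> \<le> \<beta>"
    "\<And>x y y'. x \<in> {a..b} \<Longrightarrow> \<bar>slope x y - slope x y'\<bar> \<le> C * dist y y' powr \<alpha>"
    "\<And>x y y'. x \<in> {a..b} \<Longrightarrow>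
      \<bar>linearization x y - linearization x y'\<bar> \<le> C * dist y y' powr \<alpha>"
proof -
  obtain \<alpha> C where \<alpha>: "0 < \<alpha>" "\<alpha> \<le> \<beta>" "0 \<le> C"
    and log: "\<And>x y y'. x \<in> {a..b} \<Longrightarrow> \<bar>log_slope x y - log_slope x y'\<bar> \<le> C * dist y y' powr \<alpha>"
    using log_slope_hoelder by blast
  have db: "0 \<le> slope_bound"
    by (simp add: slope_bound_def)
  have dens: "\<bar>slope x y - slope x y'\<bar> \<le> slope_bound * C * dist y y' powr \<alpha>"
    if x: "x \<in> {a..b}" for x y y'
  proof -
    \<comment> \<open>The derivative of \<open>exp\<close> is at most \<open>slope_bound\<close> on
      the half-line up to \<open>ln slope_bound\<close>.\<close>
    have "\<bar>exp u - exp v\<bar> \<le> slope_bound * \<bar>u - v\<bar>"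
      if "exp u \<le> slope_bound" "exp v \<le> slope_bound" for u v :: real
      using field_differentiable_bound [of "{..ln slope_bound}" exp exp slope_bound u v] that
      by (auto intro!: DERIV_exp DERIV_subset simp: slope_bound_def)
    then have "\<bar>slope x y - slope x y'\<bar> \<le> slope_bound * \<bar>log_slope x y - log_slope x y'\<bar>"
      using slope_le [OF x, of y] slope_le [OF x, of y'] by (simp add: slope_def)
    also have "\<dots> \<le> slope_bound * (C * dist y y' powr \<alpha>)"
      using log x db by (intro mult_left_mono) auto
    finally show ?thesis
      by (simp add: mult.assoc)
  qed
  \<comment> \<open>The oscillation of \<open>W\<close> is at most \<open>b - a\<close>, which
    allows its exponent \<beta> to be lowered to \<alpha>.\<close>
  define K' where "K' = max K (b - a)"
  have hoelder_W': "\<bar>W y - W y'\<bar> \<le> K' * dist y y' powr \<alpha>" for y y'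
    unfolding K'_def
    by (rule hoelder_exponent_mono [OF hoelder_W]) (use W_in [of y] W_in [of y'] K \<alpha> in auto)
  define C' where "C' = slope_bound * (C * (b - a) + K')"
  have lin: "\<bar>linearization x y - linearization x y'\<bar> \<le> C' * dist y y' powr \<alpha>"
    if x: "x \<in> {a..b}" for x y y'
  proof -
    define f where "f = (\<lambda>x. linearization x y - linearization x y')"
    have "norm (f x - f (W y)) \<le> slope_bound * C * dist y y' powr \<alpha> * norm (x - W y)"
      unfolding f_def
      by (rule field_differentiable_bound [OF convex_real_interval(5) DERIV_diff
            [OF has_derivative_linearization has_derivative_linearization]])
        (use dens x W_in in auto)
    also have "\<dots> \<le> slope_bound * C * dist y y' powr \<alpha> * (b - a)"
      using x W_in [of y] db \<alpha> by (intro mult_left_mono) auto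
    finally have 1: "\<bar>f x - f (W y)\<bar> \<le> slope_bound * C * dist y y' powr \<alpha> * (b - a)"
      by simp
    \<comment> \<open>The linearization over \<open>y\<close> vanishes at \<open>W y\<close>, and
      the one over \<open>y'\<close> at \<open>W y'\<close>; the latter zero is inserted for
      comparison.\<close>
    have "\<bar>f (W y)\<bar> = \<bar>linearization (W y) y' - linearization (W y') y'\<bar>"
      by (simp add: f_def linearization_def)
    also have "\<dots> \<le> slope_bound * \<bar>W y - W y'\<bar>"
      by (rule linearization_lipschitz [OF W_in W_in])
    also have "\<dots> \<le> slope_bound * (K' * dist y y' powr \<alpha>)"
      using db hoelder_W' by (intro mult_left_mono) auto
    finally show ?thesis
      using 1 by (simp add: f_def C'_def algebra_simps)
  qed
  show thesis
  proof
    show "0 < \<alpha>" "\<alpha> \<le> \<beta>" by fact+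
    show "\<bar>slope x y - slope x y'\<bar> \<le> max (slope_bound * C) C' * dist y y' powr \<alpha>"
      if "x \<in> {a..b}" for x y y'
      using dens [OF that, of y y'] by (rule order_trans) (intro mult_right_mono, auto)
    show "\<bar>linearization x y - linearization x y'\<bar> \<le> max (slope_bound * C) C' * dist y y' powr \<alpha>"
      if "x \<in> {a..b}" for x y y'
      using lin [OF that] by (rule order_trans) (intro mult_right_mono, auto)
  qed
qed

lemma linearization_cong_rel:
  assumes "\<And>y y'. R y y' \<Longrightarrow> R (T y) (T y')" "\<And>x y y'. R y y' \<Longrightarrow> G x y = G x y'"
    "\<And>x y y'. R y y' \<Longrightarrow> G1 x y = G1 x y'" "\<And>y y'. R y y' \<Longrightarrow> W y = W y'" "R y y'"
  shows "linearization x y = linearization x y'"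
proof -
  note R = fibre_orbit_cong_rel [of R T G, OF assms(1,2,5)]
  have "log_ratio n x y = log_ratio n x y'" for n x
    by (simp add: log_ratio_def R(2) [of n x] assms(3) [OF R(1)] assms(4) [OF R(1)])
  then show ?thesis
    unfolding linearization_def slope_def log_slope_def assms(4) [OF assms(5)] by simp
qed

end

section \<open>The function spaces\<close>

text \<open>This lemma and the next three pass between finiteness of an extended real norm and
  explicit real constants.\<close>

lemma sup_norm_finiteD:
  assumes "sup_norm I g < \<infinity>"
  obtains C where "\<And>x y. x \<in> I \<Longrightarrow> \<bar>g x y\<bar> \<le> C"
proof
  fix x y assume "x \<in> I"
  then have "ennreal \<bar>g x y\<bar> \<le> sup_norm I g"
    unfolding sup_norm_def by (intro SUP_upper2 [of "(x, y)"]) auto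
  also have "\<dots> = ennreal (enn2real (sup_norm I g))"
    using assms by simp
  finally show "\<bar>g x y\<bar> \<le> enn2real (sup_norm I g)"
    by (simp add: ennreal_le_iff)
qed

lemma sup_norm_finiteI:
  assumes "\<And>x y. x \<in> I \<Longrightarrow> \<bar>g x y\<bar> \<le> C"
  shows "sup_norm I g < \<infinity>"
proof -
  have "sup_norm I g \<le> ennreal C"
    unfolding sup_norm_def using assms by (intro SUP_least) (auto intro!: ennreal_leI)
  then show ?thesis
    by (simp add: le_less_trans)
qed

lemma hoelder_seminorm_finiteD:
  assumes "hoelder_seminorm I \<alpha> g < \<infinity>"
  obtains C where "0 \<le> C" "\<And>x y y'. x \<in> I \<Longrightarrow> \<bar>g x y - g x y'\<bar> \<le> C * dist y y' powr \<alpha>"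
proof
  let ?C = "enn2real (hoelder_seminorm I \<alpha> g)"
  show "0 \<le> ?C" by simp
  fix x y y' assume x: "x \<in> I"
  show "\<bar>g x y - g x y'\<bar> \<le> ?C * dist y y' powr \<alpha>"
  proof (cases "y = y'")
    case False
    with x have "ennreal (\<bar>g x y - g x y'\<bar> / norm (y - y') powr \<alpha>) \<le> hoelder_seminorm I \<alpha> g"
      unfolding hoelder_seminorm_def by (intro SUP_upper2 [of "(x, y', y)"]) auto
    also have "\<dots> = ennreal ?C"
      using assms by simp
    finally have "\<bar>g x y - g x y'\<bar> / norm (y - y') powr \<alpha> \<le> ?C"
      by (simp add: ennreal_le_iff)
    then show ?thesis
      using False by (simp add: dist_norm divide_le_eq)
  qed simp
qed

lemma hoelder_seminorm_finiteI:
  assumes "\<And>x y y'. x \<in> I \<Longrightarrow> \<bar>g x y - g x y'\<bar> \<le> C * dist y y' powr \<alpha>"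
  shows "hoelder_seminorm I \<alpha> g < \<infinity>"
proof -
  have "hoelder_seminorm I \<alpha> g \<le> ennreal C"
    unfolding hoelder_seminorm_def
  proof (intro SUP_least, clarify)
    fix x y y' assume "x \<in> I" "y \<noteq> (y' :: real ^ 2)"
    then show "ennreal (\<bar>g x y' - g x y\<bar> / norm (y' - y) powr \<alpha>) \<le> ennreal C"
      using assms [of x y' y] by (intro ennreal_leI) (simp add: dist_norm divide_le_eq)
  qed
  then show ?thesis
    by (simp add: le_less_trans)
qed

text \<open>Positivity of \<alpha> matters: in \<open>ennreal\<close> a weight 0 would turn an
  infinite seminorm into 0.\<close>

lemma Bspace_finite:
  assumes "g \<in> Bspace \<alpha> k I" "0 < \<alpha>"
  shows "n \<le> k \<Longrightarrow> sup_norm I ((dphi I ^^ n) g) < \<infinity>"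
    and "n < k \<Longrightarrow> hoelder_seminorm I \<alpha> ((dphi I ^^ n) g) < \<infinity>"
proof -
  have "(\<Sum>n\<le>k. sup_norm I ((dphi I ^^ n) g))
      + ennreal \<alpha> * (\<Sum>n<k. hoelder_seminorm I \<alpha> ((dphi I ^^ n) g)) < \<infinity>"
    using assms by (simp add: Bspace_def)
  then have fin: "(\<Sum>n\<le>k. sup_norm I ((dphi I ^^ n) g)) < \<infinity>"
      "(\<Sum>n<k. hoelder_seminorm I \<alpha> ((dphi I ^^ n) g)) < \<infinity>"
    using assms(2) by (auto simp: ennreal_mult_less_top)
  show "sup_norm I ((dphi I ^^ n) g) < \<infinity>" if "n \<le> k"
    using fin(1) that by simp
  show "hoelder_seminorm I \<alpha> ((dphi I ^^ n) g) < \<infinity>" if "n < k"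
    using fin(2) that by simp
qed

lemma Bspace_has_derivative:
  assumes "g \<in> Bspace \<alpha> k I" "n < k" "x \<in> I"
  shows "((\<lambda>x. (dphi I ^^ n) g x y) has_real_derivative (dphi I ^^ Suc n) g x y) (at x within I)"
  using assms by (simp add: Bspace_def dphi_def vector_derivative_works
      has_real_derivative_iff_has_vector_derivative)

text \<open>One-sided derivatives at the end points are unique because the interval is not a single
  point.\<close>

lemma dphi_eqI:
  assumes "a < b" "x \<in> {a..b}" "((\<lambda>x. g x y) has_real_derivative D) (at x within {a..b})"
  shows "dphi {a..b} g x y = D"
  using assms vector_derivative_within_cbox [of a b x "\<lambda>x. g x y" D]
  by (simp add: dphi_def has_real_derivative_iff_has_vector_derivative)

lemma Bspace_2I:
  assumes "a < b" "0 < \<alpha>"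
    and "\<And>x. x \<in> {a..b} \<Longrightarrow> periodic2 (g x)"
    and g: "\<And>x y. x \<in> {a..b} \<Longrightarrow> ((\<lambda>x. g x y) has_real_derivative g1 x y) (at x within {a..b})"
    and g1: "\<And>x y. x \<in> {a..b} \<Longrightarrow> ((\<lambda>x. g1 x y) has_real_derivative g2 x y) (at x within {a..b})"
    and g2: "\<And>y. continuous_on {a..b} (\<lambda>x. g2 x y)"
    and bounds: "\<And>x y. x \<in> {a..b} \<Longrightarrow> \<bar>g x y\<bar> \<le> C" "\<And>x y. x \<in> {a..b} \<Longrightarrow> \<bar>g1 x y\<bar> \<le> C1"
      "\<And>x y. x \<in> {a..b} \<Longrightarrow> \<bar>g2 x y\<bar> \<le> C2"
    and hoelder: "\<And>x y y'. x \<in> {a..b} \<Longrightarrow> \<bar>g x y - g x y'\<bar> \<le> D * dist y y' powr \<alpha>"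
      "\<And>x y y'. x \<in> {a..b} \<Longrightarrow> \<bar>g1 x y - g1 x y'\<bar> \<le> D1 * dist y y' powr \<alpha>"
  shows "g \<in> Bspace \<alpha> 2 {a..b}"
proof -
  let ?d = "dphi {a..b}"
  have d1: "?d g x y = g1 x y" if "x \<in> {a..b}" for x y
    using dphi_eqI [OF assms(1) that g [OF that]] .
  \<comment> \<open>\<open>dphi\<close> agrees with \<open>g1\<close> only on the interval, so the
    derivative is transferred within that set.\<close>
  have D1: "((\<lambda>x. ?d g x y) has_real_derivative g2 x y) (at x within {a..b})" if "x \<in> {a..b}" for x y
    by (rule has_field_derivative_transform_within [OF g1 [OF that] zero_less_one that]) (simp add: d1)
  have d2: "?d (?d g) x y = g2 x y" if "x \<in> {a..b}" for x y
    using dphi_eqI [OF assms(1) that D1 [OF that]] .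
  have diff: "(\<lambda>x. (?d ^^ n) g x y) differentiable (at x within {a..b})"
    if "n < 2" "x \<in> {a..b}" for n x y
  proof -
    from \<open>n < 2\<close> consider "n = 0" | "n = Suc 0"
      by linarith
    then show ?thesis
      using g [OF that(2)] D1 [OF that(2)]
      by cases (auto simp: real_differentiable_def)
  qed
  have cont: "continuous_on {a..b} (\<lambda>x. (?d ^^ 2) g x y)" for y
    using continuous_on_eq [OF g2 [of y], of "\<lambda>x. ?d (?d g) x y"] d2
    by (simp add: numeral_2_eq_2)
  have "sup_norm {a..b} g < \<infinity>" "sup_norm {a..b} (?d g) < \<infinity>" "sup_norm {a..b} (?d (?d g)) < \<infinity>"
    using sup_norm_finiteI [of "{a..b}" g C] sup_norm_finiteI [of "{a..b}" "?d g" C1]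
      sup_norm_finiteI [of "{a..b}" "?d (?d g)" C2] bounds d1 d2 by presburger+
  moreover have "hoelder_seminorm {a..b} \<alpha> g < \<infinity>" "hoelder_seminorm {a..b} \<alpha> (?d g) < \<infinity>"
    using hoelder_seminorm_finiteI [of "{a..b}" g D \<alpha>] hoelder_seminorm_finiteI [of "{a..b}" "?d g" D1 \<alpha>]
      hoelder d1 by presburger+
  ultimately have "(\<Sum>n\<le>2. sup_norm {a..b} ((?d ^^ n) g))
      + ennreal \<alpha> * (\<Sum>n<2. hoelder_seminorm {a..b} \<alpha> ((?d ^^ n) g)) < \<infinity>"
    by (simp add: numeral_2_eq_2 ennreal_mult_less_top)
  then show ?thesis
    unfolding Bspace_def using assms(3) diff cont by blast
qed

lemma periodic2_dphi:
  assumes "\<And>x. periodic2 (g x)"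
  shows "periodic2 (dphi UNIV g x)"
  using assms by (simp add: periodic2_def dphi_def)

section \<open>The torus and the eigendirections\<close>

lemma lattice_vec_mult:
  assumes "\<And>i j. A $ i $ j \<in> \<int>" "lattice_vec p"
  shows "lattice_vec (A *v p)"
proof -
  obtain m where p: "p = (\<chi> i. 2 * pi * of_int (m $ i))"
    using assms(2) unfolding lattice_vec_def by blast
  define k where "k i j = \<lfloor>A $ i $ j\<rfloor>" for i j
  have k: "A $ i $ j = of_int (k i j)" for i j
    using Ints_cases [OF assms(1) [of i j]] by (metis k_def floor_of_int)
  have "A *v p = (\<chi> i. 2 * pi * of_int ((\<chi> i. \<Sum>j\<in>UNIV. k i j * m $ j) $ i))"
    unfolding vec_eq_iff p matrix_vector_mult_def
    by (simp add: k sum_distrib_left mult.left_commute mult.assoc)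
  then show ?thesis
    unfolding lattice_vec_def by blast
qed

text \<open>The closed period square stands in for the compact torus.\<close>

lemma ex_lattice_translate: "\<exists>p. lattice_vec p \<and> y + p \<in> cbox 0 (\<chi> i. 2 * pi)"
proof (intro exI conjI)
  let ?m = "(\<chi> i. - \<lfloor>y $ i / (2 * pi)\<rfloor>) :: int ^ 2"
  show "lattice_vec (\<chi> i. 2 * pi * of_int (?m $ i))"
    unfolding lattice_vec_def by blast
  have "0 \<le> t - 2 * pi * of_int \<lfloor>t / (2 * pi)\<rfloor> \<and> t - 2 * pi * of_int \<lfloor>t / (2 * pi)\<rfloor> \<le> 2 * pi" for t
  proof -
    have "of_int \<lfloor>t / (2 * pi)\<rfloor> \<le> t / (2 * pi)" "t / (2 * pi) \<le> of_int \<lfloor>t / (2 * pi)\<rfloor> + 1"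
      by linarith+
    then have "of_int \<lfloor>t / (2 * pi)\<rfloor> * (2 * pi) \<le> t" "t \<le> (of_int \<lfloor>t / (2 * pi)\<rfloor> + 1) * (2 * pi)"
      by (simp_all only: pos_le_divide_eq pos_divide_le_eq pi_gt_zero mult_pos_pos zero_less_numeral)
    then show ?thesis
      by (simp add: algebra_simps)
  qed
  then show "y + (\<chi> i. 2 * pi * of_int (?m $ i)) \<in> cbox 0 (\<chi> i. 2 * pi)"
    by (simp add: mem_box_cart)
qed

text \<open>The minimum over the compact period square is a bound everywhere by periodicity. This
  makes the pointwise strict inequalities of the hypotheses uniform.\<close>

lemma periodic_positive_lower_bound:
  assumes "compact I" "continuous_on (I \<times> UNIV) (\<lambda>(x, y). g x y)"
    and "\<And>x. x \<in> I \<Longrightarrow> periodic2 (g x)" "\<And>x y. x \<in> I \<Longrightarrow> 0 < g x y"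
  obtains c :: real where "0 < c" "\<And>x y. x \<in> I \<Longrightarrow> c \<le> g x y"
proof (cases "I = {}")
  case True
  then show thesis
    using that [of 1] by simp
next
  case False
  let ?Q = "cbox 0 (\<chi> i. 2 * pi) :: (real ^ 2) set"
  have "?Q \<noteq> {}"
    using ex_lattice_translate [of 0] by blast
  with False obtain z where z: "z \<in> I \<times> ?Q" "\<And>w. w \<in> I \<times> ?Q \<Longrightarrow> (\<lambda>(x, y). g x y) z \<le> (\<lambda>(x, y). g x y) w"
    using continuous_attains_inf [of "I \<times> ?Q" "\<lambda>(x, y). g x y"] assms(1)
      continuous_on_subset [OF assms(2), of "I \<times> ?Q"] compact_Times [OF assms(1) compact_cbox]
    by blast
  show thesis
  proof
    show "0 < g (fst z) (snd z)"
      using z(1) assms(4) by auto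
    fix x y assume x: "x \<in> I"
    obtain p where p: "lattice_vec p" "y + p \<in> ?Q"
      using ex_lattice_translate by blast
    have "g (fst z) (snd z) \<le> g x (y + p)"
      using z(2) [of "(x, y + p)"] x p by (simp add: case_prod_beta)
    then show "g (fst z) (snd z) \<le> g x y"
      using assms(3) [OF x] p by (simp add: periodic2_def)
  qed
qed

text \<open>\<open>Bspace\<close> asks for continuity in the fibre variable only; joint continuity
  is recovered from the two separate moduli.\<close>

lemma continuous_on_lipschitz_hoelder:
  fixes g :: "real \<Rightarrow> 'a :: metric_space \<Rightarrow> real"
  assumes "0 < \<alpha>"
    and "\<And>x x' y. \<bar>g x y - g x' y\<bar> \<le> C * \<bar>x - x'\<bar>"
    and "\<And>x y y'. \<bar>g x y - g x y'\<bar> \<le> D * dist y y' powr \<alpha>"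
  shows "continuous_on X (\<lambda>(x, y). g x y)"
  unfolding continuous_on_def
proof
  fix z assume "z \<in> X"
  have "((\<lambda>w. g (fst w) (snd w)) \<longlongrightarrow> g (fst z) (snd z)) (at z within X)"
  proof (rule Lim_null_comparison [THEN Lim_null [THEN iffD2]])
    show "\<forall>\<^sub>F w in at z within X. norm (g (fst w) (snd w) - g (fst z) (snd z)) \<le>
        C * \<bar>fst w - fst z\<bar> + D * dist (snd w) (snd z) powr \<alpha>"
    proof (intro always_eventually allI)
      fix w show "norm (g (fst w) (snd w) - g (fst z) (snd z)) \<le>
        C * \<bar>fst w - fst z\<bar> + D * dist (snd w) (snd z) powr \<alpha>"
        using assms(2) [of "fst w" "snd w" "fst z"] assms(3) [of "fst z" "snd w" "snd z"]
        unfolding real_norm_def by linarith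
    qed
    have "((\<lambda>w. C * \<bar>fst w - fst z\<bar> + D * dist (snd w) (snd z) powr \<alpha>) \<longlongrightarrow>
        C * \<bar>fst z - fst z\<bar> + D * dist (snd z) (snd z) powr \<alpha>) (at z within X)"
      using assms(1) by (intro tendsto_intros) auto
    then show "((\<lambda>w. C * \<bar>fst w - fst z\<bar> + D * dist (snd w) (snd z) powr \<alpha>) \<longlongrightarrow> 0) (at z within X)"
      by simp
  qed
  then show "((\<lambda>(x, y). g x y) \<longlongrightarrow> (case z of (x, y) \<Rightarrow> g x y)) (at z within X)"
    by (simp add: case_prod_beta')
qed

text \<open>If the determinant vanished, the vectors would be parallel; applying \<open>A\<close> to
  that relation would force the eigenvalues to agree.\<close>

lemma eigenvectors_det_nonzero:
  fixes A :: "real ^ 2 ^ 2"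
  assumes "A *v v = \<mu> *\<^sub>R v" "A *v w = \<nu> *\<^sub>R w" "\<mu> \<noteq> \<nu>" "v \<noteq> 0" "w \<noteq> 0"
  shows "v $ 1 * w $ 2 - v $ 2 * w $ 1 \<noteq> 0"
proof
  assume 0: "v $ 1 * w $ 2 - v $ 2 * w $ 1 = 0"
  have "w $ i = 0" for i
  proof -
    have par: "w $ i *\<^sub>R v = v $ i *\<^sub>R w"
      using 0 exhaust_2 [of i] by (auto simp: vec_eq_iff forall_2 mult.commute)
    then have "w $ i *\<^sub>R (\<mu> *\<^sub>R v) = v $ i *\<^sub>R (\<nu> *\<^sub>R w)"
      using assms(1,2) by (metis matrix_vector_mult_scaleR)
    also have "\<dots> = \<nu> *\<^sub>R (w $ i *\<^sub>R v)"
      by (simp add: par mult.commute)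
    finally have "((\<mu> - \<nu>) * w $ i) *\<^sub>R v = 0"
      by (simp add: algebra_simps)
    then show ?thesis
      using assms by simp
  qed
  then show False
    using assms(5) by (simp add: vec_eq_iff)
qed

text \<open>Cramer's rule: each coefficient is a determinant divided by the fixed \<delta>, hence
  linearly bounded in \<open>norm d\<close>.\<close>

lemma bounded_decomposition:
  fixes v w :: "real ^ 2"
  assumes "v $ 1 * w $ 2 - v $ 2 * w $ 1 \<noteq> 0"
  obtains C where "0 \<le> C" "\<And>d. \<exists>s t. d = s *\<^sub>R v + t *\<^sub>R w \<and> \<bar>s\<bar> \<le> C * norm d \<and> \<bar>t\<bar> \<le> C * norm d"
proof -
  define \<delta> where "\<delta> = v $ 1 * w $ 2 - v $ 2 * w $ 1"
  have \<delta>: "\<delta> \<noteq> 0"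
    using assms by (simp add: \<delta>_def)
  define M where "M = 2 * max (norm v) (norm w) / \<bar>\<delta>\<bar>"
  have bound: "\<bar>(x $ i * u $ j - x $ k * u $ l) / \<delta>\<bar> \<le> M * norm x"
    if "norm u \<le> max (norm v) (norm w)" for x u :: "real ^ 2" and i j k l
  proof -
    have "\<bar>x $ i * u $ j\<bar> \<le> norm x * max (norm v) (norm w)" for i j
      unfolding abs_mult using component_le_norm_cart [of x i] component_le_norm_cart [of u j] that
      by (intro mult_mono) auto
    from this [of i j] this [of k l]
    have "\<bar>x $ i * u $ j - x $ k * u $ l\<bar> \<le> 2 * max (norm v) (norm w) * norm x"
      by (simp add: mult.commute mult.left_commute)
    then show ?thesis
      by (simp add: M_def abs_divide divide_right_mono)
  qed
  show thesis
  proof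
    show "0 \<le> M"
      by (simp add: M_def le_max_iff_disj)
    show "\<exists>s t. d = s *\<^sub>R v + t *\<^sub>R w \<and> \<bar>s\<bar> \<le> M * norm d \<and> \<bar>t\<bar> \<le> M * norm d" for d
    proof (intro exI conjI)
      show "\<bar>(d $ 1 * w $ 2 - d $ 2 * w $ 1) / \<delta>\<bar> \<le> M * norm d"
        "\<bar>(d $ 2 * v $ 1 - d $ 1 * v $ 2) / \<delta>\<bar> \<le> M * norm d"
        by (intro bound; simp)+
      show "d = ((d $ 1 * w $ 2 - d $ 2 * w $ 1) / \<delta>) *\<^sub>R v + ((d $ 2 * v $ 1 - d $ 1 * v $ 2) / \<delta>) *\<^sub>R w"
        unfolding vec_eq_iff forall_2 using \<delta>
        by (simp add: field_simps) (simp add: \<delta>_def algebra_simps)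
    qed
  qed
qed

lemma dir_seminorm_finiteD:
  assumes "dir_seminorm v \<alpha> g < \<infinity>"
  obtains C where "0 \<le> C" "\<And>y s. \<bar>g (y + s *\<^sub>R v) - g y\<bar> \<le> C * \<bar>s\<bar> powr \<alpha>"
proof
  let ?C = "enn2real (dir_seminorm v \<alpha> g)"
  show "0 \<le> ?C" by simp
  fix y s
  show "\<bar>g (y + s *\<^sub>R v) - g y\<bar> \<le> ?C * \<bar>s\<bar> powr \<alpha>"
  proof (cases "s = 0")
    case False
    then have "ennreal (\<bar>g (y + s *\<^sub>R v) - g y\<bar> / \<bar>s\<bar> powr \<alpha>) \<le> dir_seminorm v \<alpha> g"
      unfolding dir_seminorm_def by (intro SUP_upper2 [of "(y, s)"]) auto
    also have "\<dots> = ennreal ?C"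
      using assms by simp
    finally have "\<bar>g (y + s *\<^sub>R v) - g y\<bar> / \<bar>s\<bar> powr \<alpha> \<le> ?C"
      by (simp add: ennreal_le_iff)
    then show ?thesis
      using False by (simp add: divide_le_eq)
  qed simp
qed

text \<open>The segment from \<open>y'\<close> to \<open>y\<close> is replaced by a step along
  \<open>vp\<close> followed by one along \<open>vm\<close>, both of length at most a constant times
  \<open>norm (y - y')\<close>. The oscillation bound \<open>D\<close> reduces both exponents to
  their minimum.\<close>

lemma Bstar_hoelder:
  assumes "g \<in> Bstar vm vp \<alpha>m \<alpha>p" "0 < \<alpha>m" "0 < \<alpha>p"
    and "vp $ 1 * vm $ 2 - vp $ 2 * vm $ 1 \<noteq> 0"
    and bound: "\<And>y y'. \<bar>g y - g y'\<bar> \<le> D"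
  obtains C where "\<And>y y'. \<bar>g y - g y'\<bar> \<le> C * dist y y' powr min \<alpha>m \<alpha>p"
proof -
  let ?\<beta> = "min \<alpha>m \<alpha>p"
  have "dir_seminorm vm \<alpha>m g < \<infinity>" "dir_seminorm vp \<alpha>p g < \<infinity>"
    using assms(1-3) by (auto simp: Bstar_def ennreal_mult_less_top)
  then obtain Cm Cp where C0: "0 \<le> Cm" "0 \<le> Cp"
    and steps: "\<And>y s. \<bar>g (y + s *\<^sub>R vm) - g y\<bar> \<le> Cm * \<bar>s\<bar> powr \<alpha>m" "\<And>y s. \<bar>g (y + s *\<^sub>R vp) - g y\<bar> \<le> Cp * \<bar>s\<bar> powr \<alpha>p"
    by (metis dir_seminorm_finiteD)
  have dir: "\<bar>g (y + s *\<^sub>R vm) - g y\<bar> \<le> max Cm D * \<bar>s\<bar> powr ?\<beta>"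
      "\<bar>g (y + s *\<^sub>R vp) - g y\<bar> \<le> max Cp D * \<bar>s\<bar> powr ?\<beta>" for y s
    using steps bound assms(2,3) C0 by (auto intro!: hoelder_exponent_mono [of _ Cm _ \<alpha>m] hoelder_exponent_mono [of _ Cp _ \<alpha>p])
  obtain M where M: "0 \<le> M" "\<And>d. \<exists>s t. d = s *\<^sub>R vp + t *\<^sub>R vm \<and> \<bar>s\<bar> \<le> M * norm d \<and> \<bar>t\<bar> \<le> M * norm d"
    using bounded_decomposition [OF assms(4)] by blast
  show thesis
  proof
    fix y y'
    obtain s t where st: "y - y' = s *\<^sub>R vp + t *\<^sub>R vm" "\<bar>s\<bar> \<le> M * norm (y - y')" "\<bar>t\<bar> \<le> M * norm (y - y')"
      using M(2) by blast
    have pw: "\<bar>u\<bar> powr ?\<beta> \<le> M powr ?\<beta> * dist y y' powr ?\<beta>" if "\<bar>u\<bar> \<le> M * norm (y - y')" for u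
      using that assms(2,3) M(1) powr_mono2 [of ?\<beta> "\<bar>u\<bar>" "M * norm (y - y')"]
      by (simp add: powr_mult dist_norm)
    have y: "y = y' + s *\<^sub>R vp + t *\<^sub>R vm"
      using st(1) by (simp add: algebra_simps)
    have "\<bar>g y - g y'\<bar> \<le> \<bar>g (y' + s *\<^sub>R vp + t *\<^sub>R vm) - g (y' + s *\<^sub>R vp)\<bar> + \<bar>g (y' + s *\<^sub>R vp) - g y'\<bar>"
      unfolding y [symmetric] by linarith
    also have "\<dots> \<le> max Cm D * \<bar>t\<bar> powr ?\<beta> + max Cp D * \<bar>s\<bar> powr ?\<beta>"
      by (intro add_mono dir)
    also have "\<dots> \<le> max Cm D * (M powr ?\<beta> * dist y y' powr ?\<beta>) + max Cp D * (M powr ?\<beta> * dist y y' powr ?\<beta>)"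
      using C0 st by (intro add_mono mult_left_mono pw) auto
    finally show "\<bar>g y - g y'\<bar> \<le> ((max Cm D + max Cp D) * M powr ?\<beta>) * dist y y' powr ?\<beta>"
      by (simp add: algebra_simps)
  qed
qed

section \<open>Attraction and conjugacy\<close>

text \<open>By monotonicity a step towards the zero \<open>S y\<close> cannot overshoot it. All
  zeros lie in \<open>{a..b}\<close>, so this interval is never left, and outside it each step gains
  at least \<open>c\<close> until it is reached.\<close>

lemma fibre_orbit_trapped:
  fixes F :: "real \<Rightarrow> 'a \<Rightarrow> real"
  assumes order: "l \<le> a" "b \<le> r" and "0 < c"
    and mono: "\<And>x x' y. l \<le> x \<Longrightarrow> x \<le> x' \<Longrightarrow> x' \<le> r \<Longrightarrow> x + F x y \<le> x' + F x' y"
    and S: "\<And>y. S y \<in> {a..b}" "\<And>y. F (S y) y = 0"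
    and sign: "\<And>x y. l \<le> x \<Longrightarrow> x \<le> S y \<Longrightarrow> 0 \<le> F x y" "\<And>x y. S y \<le> x \<Longrightarrow> x \<le> r \<Longrightarrow> F x y \<le> 0"
    and strict: "\<And>x y. l \<le> x \<Longrightarrow> x \<le> a \<Longrightarrow> c \<le> F x y" "\<And>x y. b \<le> x \<Longrightarrow> x \<le> r \<Longrightarrow> F x y \<le> - c"
  shows "x \<in> {l..r} \<Longrightarrow> x + F x y \<in> {l..r}"
    and "\<exists>N. \<forall>n\<ge>N. \<forall>x\<in>{l..r}. \<forall>y. fibre_orbit (\<lambda>x y. x + F x y) T n x y \<in> {a..b}"
proof -
  have S': "a \<le> S y" "S y \<le> b" for y
    using S(1) [of y] by auto
  have cS: "min a (l + real (Suc n) * c) \<le> min a (l + n * c) + c"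
    "max b (r - n * c) - c \<le> max b (r - real (Suc n) * c)" for n :: nat
    using \<open>0 < c\<close> by (auto simp: distrib_right)
  \<comment> \<open>The sign of \<open>F\<close> gives the bound by \<open>x\<close>; monotonicity
    compared with the fixed point \<open>S y\<close> gives the other.\<close>
  have step: "min x (S y) \<le> x + F x y \<and> x + F x y \<le> max x (S y)" if x: "x \<in> {l..r}" for x y
  proof (cases "x \<le> S y")
    case True
    then show ?thesis
      using mono [of x "S y" y] sign(1) [of x y] x S' [of y] S(2) [of y] order by auto
  next
    case False
    then show ?thesis
      using mono [of "S y" x y] sign(2) [of y x] x S' [of y] S(2) [of y] order by auto
  qed
  show maps: "x + F x y \<in> {l..r}" if "x \<in> {l..r}" for x y
    using step [OF that, of y] that S' [of y] order by auto
  let ?o = "fibre_orbit (\<lambda>x y. x + F x y) T"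
  \<comment> \<open>Two barriers advance by \<open>c\<close> per step from the ends of
    \<open>{l..r}\<close> and stop at \<open>a\<close> and \<open>b\<close>; the orbit stays between
    them.\<close>
  have o: "?o n x y \<in> {l..r} \<and> min a (l + n * c) \<le> ?o n x y \<and> ?o n x y \<le> max b (r - n * c)"
    if "x \<in> {l..r}" for n x y
  proof (induction n)
    case 0
    then show ?case
      using that by auto
  next
    case (Suc n)
    let ?x = "?o n x y" and ?y = "(T ^^ n) y"
    have "min a (l + real (Suc n) * c) \<le> ?x + F ?x ?y"
    proof (cases "?x \<le> a")
      case True
      then show ?thesis
        using Suc strict(1) [of ?x ?y] cS(1) [of n] by auto
    next
      case False
      then have "a \<le> ?x + F ?x ?y"
        using Suc step [of ?x ?y] S' [of ?y] by auto
      then show ?thesis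
        by simp
    qed
    moreover have "?x + F ?x ?y \<le> max b (r - real (Suc n) * c)"
    proof (cases "b \<le> ?x")
      case True
      then show ?thesis
        using Suc strict(2) [of ?x ?y] cS(2) [of n] by auto
    next
      case False
      then have "?x + F ?x ?y \<le> b"
        using Suc step [of ?x ?y] S' [of ?y] by auto
      then show ?thesis
        by simp
    qed
    ultimately show ?case
      using maps Suc by simp
  qed
  obtain N :: nat where N: "(r - l) / c \<le> N"
    using real_arch_simple by blast
  have "?o n x y \<in> {a..b}" if "N \<le> n" "x \<in> {l..r}" for n x y
  proof -
    have "(r - l) / c \<le> n"
      using N that by linarith
    then have "r - l \<le> n * c"
      using assms(3) by (simp add: divide_le_eq)
    moreover have "a \<le> r" "l \<le> b"
      using S' [of y] order by linarith+
    ultimately show ?thesis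
      using o [OF that(2), of n y] by auto
  qed
  then show "\<exists>N. \<forall>n\<ge>N. \<forall>x\<in>{l..r}. \<forall>y. ?o n x y \<in> {a..b}"
    by blast
qed

theorem theorem2:
  fixes A :: "real ^ 2 ^ 2" and \<mu>p \<mu>m :: real and vp vm :: "real ^ 2"
    and F :: "real \<Rightarrow> real ^ 2 \<Rightarrow> real" and \<alpha>0 \<alpha>m \<alpha>p :: real
    and \<phi>m \<phi>M Sm SM \<Gamma> :: real and U :: "real set" and \<Omega> \<Lambda> :: "(real \<times> (real ^ 2)) set"
    and S W \<kappa> :: "real ^ 2 \<Rightarrow> real"
  assumes anosov: "anosov_automorphism A"
    and eigenvalues: "\<bar>\<mu>p\<bar> > 1" "\<bar>\<mu>m\<bar> < 1" "\<bar>\<mu>p * \<mu>m\<bar> = 1"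
    and eigenvectors: "A *v vp = \<mu>p *\<^sub>R vp" "A *v vm = \<mu>m *\<^sub>R vm" "norm vp = 1" "norm vm = 1"
    and \<alpha>0: "0 < \<alpha>0" "\<alpha>0 \<le> 1"
    and F: "F \<in> Bspace_torus \<alpha>0 6"
    and U: "\<phi>m < \<phi>M" "\<phi>M - \<phi>m < 2 * pi" "U = {\<phi>m..\<phi>M}"
    and \<Omega>: "\<Omega> = U \<times> UNIV"
    and hyp1: "\<forall>(\<phi>, \<psi>) \<in> \<Omega>. 1 + dphi UNIV F \<phi> \<psi> > 0"
              "\<forall>\<psi>. F \<phi>m \<psi> > 0" "\<forall>\<psi>. F \<phi>M \<psi> < 0"
    and hyp2: "\<forall>\<psi>. \<exists>!s. s \<in> interior U \<and> F s \<psi> = 0"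
    and S: "\<forall>\<psi>. S \<psi> \<in> interior U \<and> F (S \<psi>) \<psi> = 0"
    and Sm: "Sm = (INF \<psi>. S \<psi>)" and SM: "SM = (SUP \<psi>. S \<psi>)"
    and \<Lambda>: "\<Lambda> = {Sm..SM} \<times> UNIV"
    and \<Gamma>: "\<Gamma> = - (SUP (\<phi>, \<psi>) \<in> \<Lambda>. dphi UNIV F \<phi> \<psi>)"
    and hyp3: "\<Gamma> > 0"
    and \<alpha>m: "0 < \<alpha>m" "\<alpha>m \<le> \<alpha>0" and \<alpha>p: "0 < \<alpha>p" "\<alpha>p \<le> \<alpha>0"
    and W_space: "W \<in> Bstar vm vp \<alpha>m \<alpha>p"
    and W_graph: "\<forall>\<psi>. (W \<psi>, \<psi>) \<in> \<Lambda>"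
    and W_invariant: "\<forall>\<psi>. skew A F (W \<psi>, \<psi>) = (W (A *v \<psi>), A *v \<psi>)"
    and \<kappa>: "\<kappa> = (\<lambda>\<psi>. 1 + dphi UNIV F (W \<psi>) \<psi>)"
  shows "\<exists>\<Omega>0 H. saturated \<Omega>0 \<and> H \<in> \<Omega> \<rightarrow> \<Omega>0 \<and>
           (\<forall>z \<in> \<Omega>. H (skew A F z) = lin_skew A \<kappa> (H z)) \<and>
           (\<exists>h \<alpha>s. 0 < \<alpha>s \<and> \<alpha>s \<le> min \<alpha>m \<alpha>p \<and> h \<in> Bspace \<alpha>s 2 U \<and>
              (\<forall>(\<phi>, \<psi>) \<in> \<Omega>. H (\<phi>, \<psi>) = (h \<phi> \<psi>, \<psi>)) \<and>
              (\<forall>\<psi>. dphi U h (W \<psi>) \<psi> = 1))"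
proof -
  note eigen_det = eigenvectors_det_nonzero [OF eigenvectors(1,2)]
  have v: "vp \<noteq> 0" "vm \<noteq> 0" "\<mu>p \<noteq> \<mu>m"
    using eigenvectors(3,4) eigenvalues(1,2) by auto
  \<comment> \<open>The common Hoelder exponent for \<open>F\<close>, its derivative and
    \<open>W\<close>.\<close>
  define \<beta> where "\<beta> = min \<alpha>m \<alpha>p"
  have \<beta>: "0 < \<beta>" "\<beta> \<le> 1" "\<beta> \<le> \<alpha>0"
    using \<alpha>m \<alpha>p \<alpha>0 by (auto simp: \<beta>_def)

  \<comment> \<open>Regularity of \<open>F\<close>\<close>
  define F1 where "F1 = dphi UNIV F"
  define F2 where "F2 = dphi UNIV F1"
  \<comment> \<open>The third derivative provides the continuity of \<open>F2\<close> along the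
    fibre.\<close>
  define F3 where "F3 = dphi UNIV F2"
  have FB: "F \<in> Bspace \<alpha>0 6 UNIV"
    using F by (simp add: Bspace_torus_def)
  have der: "((\<lambda>x. F x y) has_real_derivative F1 x y) (at x)"
      "((\<lambda>x. F1 x y) has_real_derivative F2 x y) (at x)"
      "((\<lambda>x. F2 x y) has_real_derivative F3 x y) (at x)" for x y
    using Bspace_has_derivative [OF FB, of 0 x y] Bspace_has_derivative [OF FB, of 1 x y]
      Bspace_has_derivative [OF FB, of 2 x y]
    by (simp_all add: F1_def F2_def F3_def numeral_2_eq_2)
  note fin = Bspace_finite [OF FB \<alpha>0(1)]
  obtain B0 B1 B2 where B: "\<And>x y. \<bar>F x y\<bar> \<le> B0" "\<And>x y. \<bar>F1 x y\<bar> \<le> B1" "\<And>x y. \<bar>F2 x y\<bar> \<le> B2"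
    using sup_norm_finiteD [OF fin(1) [of 0]] sup_norm_finiteD [OF fin(1) [of 1]]
      sup_norm_finiteD [OF fin(1) [of 2]]
    by (simp add: F1_def F2_def numeral_2_eq_2) metis
  obtain H0 H1 where H: "0 \<le> H0" "0 \<le> H1" "\<And>x y y'. \<bar>F x y - F x y'\<bar> \<le> H0 * dist y y' powr \<alpha>0"
      "\<And>x y y'. \<bar>F1 x y - F1 x y'\<bar> \<le> H1 * dist y y' powr \<alpha>0"
    using hoelder_seminorm_finiteD [OF fin(2) [of 0]] hoelder_seminorm_finiteD [OF fin(2) [of 1]]
    by (simp add: F1_def) metis
  have lip: "\<bar>F x y - F x' y\<bar> \<le> B1 * \<bar>x - x'\<bar>" "\<bar>F1 x y - F1 x' y\<bar> \<le> B2 * \<bar>x - x'\<bar>" for x x' y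
    using field_differentiable_bound [OF convex_UNIV der(1) [where y = y], of B1 x x']
      field_differentiable_bound [OF convex_UNIV der(2) [where y = y], of B2 x x'] B
    by simp_all
  have cont: "continuous_on X (\<lambda>(x, y). F x y)" "continuous_on X (\<lambda>(x, y). F1 x y)" for X
    using continuous_on_lipschitz_hoelder [OF \<alpha>0(1) lip(1) H(3)]
      continuous_on_lipschitz_hoelder [OF \<alpha>0(1) lip(2) H(4)] by auto
  have perF: "periodic2 (F x)" for x
    using FB by (simp add: Bspace_def)
  have perF1: "periodic2 (F1 x)" for x
    unfolding F1_def by (rule periodic2_dphi [OF perF])
  have pos1: "0 < 1 + F1 x y" if "x \<in> U" for x y
    using hyp1(1) that by (auto simp: \<Omega> F1_def)
  obtain c where c: "0 < c" "\<And>x y. x \<in> U \<Longrightarrow> c \<le> 1 + F1 x y"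
  proof (rule periodic_positive_lower_bound [of U "\<lambda>x y. 1 + F1 x y"])
    show "compact U"
      by (simp add: U)
    show "continuous_on (U \<times> UNIV) (\<lambda>(x, y). 1 + F1 x y)"
      using continuous_on_add [OF continuous_on_const cont(2)] by (simp add: case_prod_beta')
    show "periodic2 (\<lambda>y. 1 + F1 x y)" if "x \<in> U" for x
      using perF1 [of x] by (simp add: periodic2_def)
  qed (use pos1 in auto)
  have mono: "x + F x y \<le> x' + F x' y" if "\<phi>m \<le> x" "x \<le> x'" "x' \<le> \<phi>M" for x x' y
  proof (rule DERIV_nonneg_imp_nondecreasing [OF \<open>x \<le> x'\<close>])
    fix t assume "x \<le> t" "t \<le> x'"
    then show "\<exists>D. ((\<lambda>x. x + F x y) has_real_derivative D) (at t) \<and> 0 \<le> D"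
      using pos1 [of t y] that U by (intro exI [of _ "1 + F1 t y"]) (auto intro!: derivative_intros der)
  qed

  \<comment> \<open>Sign of \<open>F\<close> and contraction near \<Lambda>\<close>
  have S_in: "\<phi>m < S y" "S y < \<phi>M" "F (S y) y = 0" for y
    using S U by (auto simp: interior_atLeastAtMost_real)
  have zero: "s = S y" if "\<phi>m < s" "s < \<phi>M" "F s y = 0" for s y
    using hyp2 S that U by (auto simp: interior_atLeastAtMost_real)
  have contF: "continuous_on X (\<lambda>x. F x y)" for X y
    using der(1) by (meson DERIV_continuous_on has_field_derivative_at_within)
  \<comment> \<open>\<open>F\<close> is positive at \<open>\<phi>m\<close>; losing positivity before
    \<open>S y\<close> would create a second zero in the interior.\<close>
  have F_pos: "0 < F x y" if "\<phi>m \<le> x" "x < S y" for x y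
  proof (rule ccontr)
    assume "\<not> 0 < F x y"
    then have "\<exists>s\<ge>\<phi>m. s \<le> x \<and> F s y = 0"
      using hyp1(2) \<open>\<phi>m \<le> x\<close> by (intro IVT2' contF) (auto simp: less_imp_le)
    then obtain s where s: "\<phi>m \<le> s" "s \<le> x" "F s y = 0"
      by blast
    then have "s \<noteq> \<phi>m"
      using hyp1(2) by (metis less_irrefl)
    then show False
      using zero [of s y] s that S_in [of y] by auto
  qed
  have F_neg: "F x y < 0" if "S y < x" "x \<le> \<phi>M" for x y
  proof (rule ccontr)
    assume "\<not> F x y < 0"
    then have "\<exists>s\<ge>x. s \<le> \<phi>M \<and> F s y = 0"
      using hyp1(3) \<open>x \<le> \<phi>M\<close> by (intro IVT2' contF) (auto simp: less_imp_le)
    then obtain s where s: "x \<le> s" "s \<le> \<phi>M" "F s y = 0"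
      by blast
    then have "s \<noteq> \<phi>M"
      using hyp1(3) by (metis less_irrefl)
    then show False
      using zero [of s y] s that S_in [of y] by auto
  qed
  have "bdd_below (range S)" "bdd_above (range S)"
    using S_in by (meson bdd_belowI2 bdd_aboveI2 less_imp_le)+
  then have S_bounds: "Sm \<le> S y" "S y \<le> SM" for y
    by (simp_all add: Sm SM cINF_lower cSUP_upper)
  have SmSM: "\<phi>m \<le> Sm" "SM \<le> \<phi>M" "Sm \<le> SM"
    using order_trans [OF S_bounds] S_in
    by (auto simp: Sm SM intro!: cINF_greatest cSUP_least intro: less_imp_le)
  have F1_\<Lambda>: "F1 x y \<le> - \<Gamma>" if "x \<in> {Sm..SM}" for x y
  proof -
    have "bdd_above ((\<lambda>(x, y). F1 x y) ` \<Lambda>)"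
      using B(2) by (intro bdd_aboveI2 [of _ _ B1]) (auto simp: abs_le_iff)
    then have "(\<lambda>(x, y). F1 x y) (x, y) \<le> (SUP (x, y)\<in>\<Lambda>. F1 x y)"
      using that by (intro cSUP_upper) (auto simp: \<Lambda>)
    then show ?thesis
      by (simp add: \<Gamma> F1_def)
  qed
  \<comment> \<open>A displacement by \<epsilon> changes \<open>F1\<close> by at most half of
    \<Gamma>. The added 1 covers \<open>B2 = 0\<close>.\<close>
  define \<epsilon> where "\<epsilon> = \<Gamma> / (2 * (\<bar>B2\<bar> + 1))"
  have \<epsilon>: "0 < \<epsilon>" "\<bar>B2\<bar> * \<epsilon> \<le> \<Gamma> / 2"
    using hyp3 by (auto simp: \<epsilon>_def field_simps)
  \<comment> \<open>The neighbourhood of \<Lambda> to be reached, cut off at the ends of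
    \<open>U\<close>. It must be larger than \<Lambda> because \<open>F\<close> may vanish at
    \<open>Sm\<close> or \<open>SM\<close>, which would leave no uniform step size outside.\<close>
  define a b where "a = max \<phi>m (Sm - \<epsilon>)" and "b = min \<phi>M (SM + \<epsilon>)"
  define \<rho> where "\<rho> = 1 - \<Gamma> / 2"
  have F1_ab: "1 + F1 x y \<le> \<rho>" if "x \<in> {a..b}" for x y
  proof -
    \<comment> \<open>The nearest point of \<open>{Sm..SM}\<close>.\<close>
    define x' where "x' = max Sm (min SM x)"
    have x': "x' \<in> {Sm..SM}" "\<bar>x - x'\<bar> \<le> \<epsilon>"
      using that SmSM \<epsilon> by (auto simp: x'_def a_def b_def)
    have "F1 x y - F1 x' y \<le> B2 * \<bar>x - x'\<bar>"
      using lip(2) [of x y x'] by linarith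
    also have "\<dots> \<le> \<bar>B2\<bar> * \<epsilon>"
      using x' by (intro mult_mono) auto
    finally show ?thesis
      using F1_\<Lambda> [OF x'(1), of y] \<epsilon> by (simp add: \<rho>_def)
  qed
  have S_ab: "S y \<in> {a..b}" for y
    using S_bounds [of y] S_in [of y] \<epsilon> by (auto simp: a_def b_def)
  have \<rho>: "0 < \<rho>" "\<rho> < 1"
  proof -
    \<comment> \<open>Positivity of \<rho> follows from \<open>0 < 1 + F1\<close> at any one point
      of \<open>{a..b}\<close>; \<open>S 0\<close> serves.\<close>
    have "S 0 \<in> U"
      using S_in [of 0] U by simp
    then show "0 < \<rho>"
      using F1_ab [OF S_ab, of 0 0] pos1 [of "S 0" 0] by linarith
  qed (use hyp3 in \<open>simp add: \<rho>_def\<close>)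
  obtain ca where ca: "0 < ca" "\<And>x y. x \<in> {\<phi>m..a} \<Longrightarrow> ca \<le> F x y"
  proof (rule periodic_positive_lower_bound [of "{\<phi>m..a}" F])
    show "0 < F x y" if "x \<in> {\<phi>m..a}" for x y
      using that F_pos [of x y] hyp1(2) S_bounds [of y] S_in [of y] \<epsilon> by (auto simp: a_def)
  qed (use cont perF in auto)
  obtain cb where cb: "0 < cb" "\<And>x y. x \<in> {b..\<phi>M} \<Longrightarrow> cb \<le> - F x y"
  proof (rule periodic_positive_lower_bound [of "{b..\<phi>M}" "\<lambda>x y. - F x y"])
    show "continuous_on ({b..\<phi>M} \<times> UNIV) (\<lambda>(x, y). - F x y)"
      using continuous_on_minus [OF cont(1)] by (simp add: case_prod_beta')
    show "periodic2 (\<lambda>y. - F x y)" for x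
      using perF [of x] by (simp add: periodic2_def)
    show "0 < - F x y" if "x \<in> {b..\<phi>M}" for x y
      using that F_neg [of y x] hyp1(3) S_bounds [of y] S_in [of y] \<epsilon> by (auto simp: b_def)
  qed auto

  \<comment> \<open>Verification of the assumptions of the locale\<close>
  let ?G = "\<lambda>x y. x + F x y" and ?T = "\<lambda>y. A *v y"
  have sign: "0 \<le> F x y" if "\<phi>m \<le> x" "x \<le> S y" for x y
    using F_pos [of x y] S_in(3) [of y] that by (cases "x = S y") auto
  have sign': "F x y \<le> 0" if "S y \<le> x" "x \<le> \<phi>M" for x y
    using F_neg [of y x] S_in(3) [of y] that by (cases "x = S y") auto
  have ab: "\<phi>m \<le> a" "b \<le> \<phi>M"
    by (auto simp: a_def b_def)
  have strict: "min ca cb \<le> F x y" if "\<phi>m \<le> x" "x \<le> a" for x y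
    using ca(2) [of x y] that by auto
  have strict': "F x y \<le> - min ca cb" if "b \<le> x" "x \<le> \<phi>M" for x y
    using cb(2) [of x y] that by auto
  have cab: "0 < min ca cb"
    using ca cb by simp
  note trapped = fibre_orbit_trapped [of \<phi>m a b \<phi>M "min ca cb" F S, OF ab cab mono S_ab S_in(3)
      sign sign' strict strict']
  obtain N where N: "\<And>n x y. N \<le> n \<Longrightarrow> x \<in> {\<phi>m..\<phi>M} \<Longrightarrow> fibre_orbit ?G ?T n x y \<in> {a..b}"
    using trapped(2) [of ?T] by blast
  have W_U: "W y \<in> {\<phi>m..\<phi>M}" for y
    using W_graph [rule_format, of y] SmSM by (auto simp: \<Lambda>)
  have W_diff: "\<bar>W y - W y'\<bar> \<le> \<phi>M - \<phi>m" for y y'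
    using W_U [of y] W_U [of y'] by auto
  obtain CW where CW: "\<And>y y'. \<bar>W y - W y'\<bar> \<le> CW * dist y y' powr \<beta>"
    using Bstar_hoelder [OF W_space \<alpha>m(1) \<alpha>p(1) eigen_det [OF v(3,1,2)] W_diff]
    unfolding \<beta>_def by blast
  obtain CT where CT: "\<And>y. norm (A *v y) \<le> norm y * CT"
    using bounded_linear.bounded [OF matrix_vector_mul_bounded_linear] by blast
  have H': "\<bar>F x y - F x y'\<bar> \<le> max H0 (2 * B0) * dist y y' powr \<beta>"
      "\<bar>F1 x y - F1 x y'\<bar> \<le> max H1 (2 * B1) * dist y y' powr \<beta>" for x y y'
  proof -
    have "\<bar>F x y - F x y'\<bar> \<le> 2 * B0" "\<bar>F1 x y - F1 x y'\<bar> \<le> 2 * B1"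
      using B(1) [of x y] B(1) [of x y'] B(2) [of x y] B(2) [of x y'] by linarith+
    then show "\<bar>F x y - F x y'\<bar> \<le> max H0 (2 * B0) * dist y y' powr \<beta>"
        "\<bar>F1 x y - F1 x y'\<bar> \<le> max H1 (2 * B1) * dist y y' powr \<beta>"
      using H \<beta> by (auto intro!: hoelder_exponent_mono [where \<alpha> = \<alpha>0])
  qed
  \<comment> \<open>The entry 1 secures \<open>1 \<le> K\<close>; the others are the individual
    bounds and Hoelder or Lipschitz constants.\<close>
  define K where "K = Max {1, 1 + B1, B2, max H0 (2 * B0), max H1 (2 * B1), CW, CT}"
  have K: "1 \<le> K" "1 + B1 \<le> K" "B2 \<le> K" "max H0 (2 * B0) \<le> K" "max H1 (2 * B1) \<le> K" "CW \<le> K" "CT \<le> K"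
    unfolding K_def by (rule Max_ge; simp)+
  have scale: "t \<le> K * s" if "t \<le> C * s" "C \<le> K" "0 \<le> s" for t C s
    using that by (meson mult_right_mono order_trans)
  interpret attracting_skew_product ?T ?G "\<lambda>x y. 1 + F1 x y" F2 \<phi>m \<phi>M W K c \<beta> \<rho> N
  proof
    fix x y y' n
    show "dist (A *v y) (A *v y') \<le> K * dist y y'"
      using CT [of "y - y'"] by (intro scale [of _ CT] K)
        (simp_all add: dist_norm matrix_vector_mult_diff_distrib mult.commute)
    show "\<bar>W y - W y'\<bar> \<le> K * dist y y' powr \<beta>"
      by (rule scale [OF CW K(6)]) simp
    show "W y + F (W y) y = W (A *v y)"
      using W_invariant by (simp add: skew_def)
    assume x: "x \<in> {\<phi>m..\<phi>M}"
    show "x + F x y \<in> {\<phi>m..\<phi>M}"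
      by (rule trapped(1); (assumption | rule x))
    show "((\<lambda>x. x + F x y) has_real_derivative 1 + F1 x y) (at x within {\<phi>m..\<phi>M})"
      by (intro derivative_intros has_field_derivative_at_within [OF der(1)])
    show "((\<lambda>x. 1 + F1 x y) has_real_derivative F2 x y) (at x within {\<phi>m..\<phi>M})"
      by (auto intro!: derivative_eq_intros has_field_derivative_at_within [OF der(2)])
    show "c \<le> 1 + F1 x y"
      using c x U by simp
    show "1 + F1 x y \<le> K"
      using B(2) [of x y] K by linarith
    show "\<bar>F2 x y\<bar> \<le> K"
      using B(3) [of x y] K by linarith
    show "\<bar>x + F x y - (x + F x y')\<bar> \<le> K * dist y y' powr \<beta>"
      using scale [OF H'(1) K(4)] by simp
    show "\<bar>1 + F1 x y - (1 + F1 x y')\<bar> \<le> K * dist y y' powr \<beta>"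
      using scale [OF H'(2) K(5)] by simp
    assume "N \<le> n"
    then show "1 + F1 (fibre_orbit ?G ?T n x y) ((?T ^^ n) y) \<le> \<rho>"
      by (intro F1_ab N x)
  next
    show "continuous_on {\<phi>m..\<phi>M} (\<lambda>x. F2 x y)" for y
      using der(3) by (meson DERIV_continuous_on has_field_derivative_at_within)
  qed (use U W_U c K \<beta> \<rho> in auto)

  \<comment> \<open>Properties of the conjugacy\<close>
  obtain \<alpha>s C where \<alpha>s: "0 < \<alpha>s" "\<alpha>s \<le> \<beta>"
    and slope: "\<And>x y y'. x \<in> {\<phi>m..\<phi>M} \<Longrightarrow> \<bar>slope x y - slope x y'\<bar> \<le> C * dist y y' powr \<alpha>s"
    and lin: "\<And>x y y'. x \<in> {\<phi>m..\<phi>M} \<Longrightarrow>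
      \<bar>linearization x y - linearization x y'\<bar> \<le> C * dist y y' powr \<alpha>s"
    using linearization_hoelder by blast
  have per: "periodic2 (linearization x)" for x
    unfolding periodic2_def
  proof (intro allI impI)
    fix y p assume p: "lattice_vec p"
    \<comment> \<open>Congruence modulo the lattice, preserved by \<open>A\<close> because its
      entries are integers.\<close>
    let ?R = "\<lambda>y y'. \<exists>p. lattice_vec p \<and> y = y' + p"
    show "linearization x (y + p) = linearization x y"
    proof (rule linearization_cong_rel [of ?R])
      show "?R (A *v y) (A *v y')" if "?R y y'" for y y'
        using that lattice_vec_mult anosov
        by (auto simp: anosov_automorphism_def matrix_vector_right_distrib)
      show "W y = W y'" if "?R y y'" for y y'
        using W_space that by (auto simp: Bstar_def periodic2_def)
    qed (use perF perF1 p in \<open>auto simp: periodic2_def\<close>)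
  qed
  have cont2: "continuous_on {\<phi>m..\<phi>M} (\<lambda>x. slope x y * log_slope_deriv x y)" for y
    by (intro continuous_intros continuous_on_slope continuous_on_log_slope_deriv)
  have h: "linearization \<in> Bspace \<alpha>s 2 U"
    unfolding U(3)
    by (rule Bspace_2I [OF U(1) \<alpha>s(1) per has_derivative_linearization has_derivative_slope cont2
          linearization_bound slope_le slope_deriv_bound lin slope])
  have dh: "dphi U linearization (W y) y = 1" for y
    using dphi_eqI [OF U(1) W_U has_derivative_linearization [OF W_U]] slope_W U(3) by simp
  let ?H = "\<lambda>(x, y). (linearization x y, y)"
  have conj: "?H (skew A F z) = lin_skew A \<kappa> (?H z)" if "z \<in> \<Omega>" for z
    using that linearization_skew [of "fst z" "snd z"]
    by (auto simp: \<Omega> U skew_def lin_skew_def \<kappa> F1_def)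
  show ?thesis
    using h dh conj \<alpha>s
    \<comment> \<open>The whole space is taken as the target set \<Omega>0, so saturation and the
      mapping property are immediate.\<close>
    by (intro exI [of _ UNIV] exI [of _ ?H] exI [of _ linearization] exI [of _ \<alpha>s] conjI)
      (auto simp: saturated_def \<beta>_def)
qed

end
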